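(* For any $N\in\mathbb{N}$, the pair $(\mathfrak{G}_N,[\cdot,\cdot]_{\mathfrak{G}_N})$ is a Lie algebra. Furthermore, the bracket $[\cdot,\cdot]_{\mathfrak{G}_N}:\mathfrak{G}_N\times\mathfrak{G}_N\to\mathfrak{G}_N$ is continuous.
   Context: Fix $d\in\mathbb{N}$. Points of $\mathbb{R}^{2d}$ are $z=(x,v)$. For $k\in\mathbb{N}$, $\mathfrak{g}_k$ is the real vector space of smooth functions $f:(\mathbb{R}^{2d})^k\to\mathbb{R}$ invariant under permutations of $z_1,\dots,z_k\in\mathbb{R}^{2d}$, with the topology generated by the seminorms $\sup_{|\alpha|\le n}\|\partial^\alpha f\|_{L^\infty(K)}$ ($K$ compact, $n\in\mathbb{N}$), and $[f,g]_{\mathfrak{g}_k}:=k\sum_{i=1}^k(\nabla_{x_i}f\cdot\nabla_{v_i}g-\nabla_{v_i}f\cdot\nabla_{x_i}g)$. $\mathfrak{G}_N:=\bigoplus_{k=1}^N\mathfrak{g}_k$ with the product topology; elements are written $F=(f^{(k)})_{k=1}^N$. $P_k^N$ is the set of $k$-tuples $(j_1,\dots,j_k)$ of distinct elements of $\{1,\dots,N\}$. For $1\le k\le N$, $\epsilon_{k,N}:\mathfrak{g}_k\to\mathfrak{g}_N$ is $$\epsilon_{k,N}(f)(z_1,\dots,z_N)=\frac1{|P_k^N|}\sum_{(j_1,\dots,j_k)\in P_k^N}f(z_{j_1},\dots,z_{j_k}).$$ Each $\epsilon_{k,N}$ is injective, and for $F=(f^{(k)})_k,G=(g^{(k)})_k\in\mathfrak{G}_N$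 and $1\le k\le N$ one defines $$[F,G]_{\mathfrak{G}_N}^{(k)}:=\epsilon_{k,N}^{-1}\Big(\sum_{\substack{1\le\ell,j\le N\\\min(\ell+j-1,N)=k}}[\epsilon_{\ell,N}(f^{(\ell)}),\epsilon_{j,N}(g^{(j)})]_{\mathfrak{g}_N}\Big),$$ which is meaningful because the sum lies in the image of $\epsilon_{k,N}$. A Lie algebra means a real locally convex topological vector space with a bilinear antisymmetric bracket satisfying the Jacobi identity. *)

theory Defs
  imports "HOL-Analysis.Analysis" "HOL-Library.Function_Algebras"
begin

instantiation "fun" :: (type, real_vector) real_vector
begin

definition scaleR_fun :: "real \<Rightarrow> ('a \<Rightarrow> 'b) \<Rightarrow> 'a \<Rightarrow> 'b"
  where "scaleR_fun c f = (\<lambda>x. c *\<^sub>R f x)"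

instance
  by standard (simp_all add: scaleR_fun_def plus_fun_def fun_eq_iff algebra_simps)

end


section \<open>Locally convex spaces and Lie algebras\<close>

text \<open>The vector space is a subspace \<open>V\<close> of an ambient real vector space type, and its topology is a
  topology \<open>T\<close> with underlying set \<open>V\<close>, unrelated to any type class topology. The Hausdorff property
  is not part of the definition.\<close>

locale locally_convex_space =
  fixes V :: "'a::real_vector set" and T :: "'a topology"
  assumes subspace_carrier: "subspace V"
    and topspace_carrier: "topspace T = V"
    and continuous_add: "continuous_map (prod_topology T T) T (\<lambda>(x, y). x + y)"
    and continuous_scale: "continuous_map (prod_topology euclideanreal T) T (\<lambda>(c, x). c *\<^sub>R x)"
    and locally_convex: "\<And>U. openin T U \<Longrightarrow> 0 \<in> U \<Longrightarrow> \<exists>C. openin T C \<and> convex C \<and> 0 \<in> C \<and> C \<subseteq> U"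

locale lie_algebra = locally_convex_space V T
  for V :: "'a::real_vector set" and T :: "'a topology" +
  fixes B :: "'a \<Rightarrow> 'a \<Rightarrow> 'a"
  assumes bracket_closed: "x \<in> V \<Longrightarrow> y \<in> V \<Longrightarrow> B x y \<in> V"
    and bracket_add_left: "x \<in> V \<Longrightarrow> y \<in> V \<Longrightarrow> z \<in> V \<Longrightarrow> B (x + y) z = B x z + B y z"
    and bracket_scale_left: "x \<in> V \<Longrightarrow> y \<in> V \<Longrightarrow> B (c *\<^sub>R x) y = c *\<^sub>R B x y"
    and bracket_add_right: "x \<in> V \<Longrightarrow> y \<in> V \<Longrightarrow> z \<in> V \<Longrightarrow> B x (y + z) = B x y + B x z"
    and bracket_scale_right: "x \<in> V \<Longrightarrow> y \<in> V \<Longrightarrow> B x (c *\<^sub>R y) = c *\<^sub>R B x y"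
    and bracket_antisym: "x \<in> V \<Longrightarrow> y \<in> V \<Longrightarrow> B x y = - B y x"
    and jacobi: "x \<in> V \<Longrightarrow> y \<in> V \<Longrightarrow> z \<in> V \<Longrightarrow> B x (B y z) + B y (B z x) + B z (B x y) = 0"

definition seminorm_topology :: "'a::real_vector set \<Rightarrow> ('a \<Rightarrow> real) set \<Rightarrow> 'a topology" where
  "seminorm_topology V P = topology_generated_by
     {{g \<in> V. p (g - f) < r} | p f r. p \<in> P \<and> f \<in> V \<and> 0 < r}"


section \<open>Smooth functions of \<open>k\<close> points\<close>

text \<open>A \<open>k\<close>-tuple of points is an extensional function on \<open>{1..k}\<close>. A function of \<open>k\<close> points is
  represented by its extension by zero to all of \<open>nat \<Rightarrow> 'z\<close>, so that functions of \<open>k\<close> points form a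
  linear subspace of the pointwise vector space.\<close>

abbreviation tuples :: "nat \<Rightarrow> (nat \<Rightarrow> 'z::euclidean_space) topology" where
  "tuples k \<equiv> product_topology (\<lambda>_. euclidean) {1..k}"

definition partial :: "nat \<times> 'z::euclidean_space \<Rightarrow> ((nat \<Rightarrow> 'z) \<Rightarrow> real) \<Rightarrow> (nat \<Rightarrow> 'z) \<Rightarrow> real" where
  "partial = (\<lambda>(i, u) f Z. deriv (\<lambda>t. f (Z(i := Z i + t *\<^sub>R u))) 0)"

text \<open>Iterated coordinate derivatives are indexed by the list of coordinates to differentiate in.
  A list \<open>\<alpha>\<close> stands for the multi-index counting its entries, whose order is \<open>length \<alpha>\<close>; on smooth
  functions the ordering of the list is immaterial.\<close>

definition partials :: "(nat \<times> 'z::euclidean_space) list \<Rightarrow> ((nat \<Rightarrow> 'z) \<Rightarrow> real) \<Rightarrow> (nat \<Rightarrow> 'z) \<Rightarrow> real" where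
  "partials \<alpha> f = foldr partial \<alpha> f"

definition multi_indices :: "nat \<Rightarrow> (nat \<times> 'z::euclidean_space) list set" where
  "multi_indices k = lists ({1..k} \<times> Basis)"

definition smooth :: "nat \<Rightarrow> ((nat \<Rightarrow> 'z::euclidean_space) \<Rightarrow> real) \<Rightarrow> bool" where
  "smooth k f \<longleftrightarrow> (\<forall>\<alpha> \<in> multi_indices k.
     continuous_map (tuples k) euclideanreal (partials \<alpha> f) \<and>
     (\<forall>i \<in> {1..k}. \<forall>u \<in> Basis. \<forall>Z \<in> topspace (tuples k).
        (\<lambda>t. partials \<alpha> f (Z(i := Z i + t *\<^sub>R u))) differentiable (at 0)))"

text \<open>The value \<open>0\<close> is inserted only to give the supremum its intended value when \<open>K\<close> is empty.\<close>

definition smooth_seminorm :: "nat \<Rightarrow> nat \<Rightarrow> (nat \<Rightarrow> 'z::euclidean_space) set \<Rightarrow> ((nat \<Rightarrow> 'z) \<Rightarrow> real) \<Rightarrow> real" where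
  "smooth_seminorm k n K f =
     Sup (insert 0 {\<bar>partials \<alpha> f Z\<bar> | \<alpha> Z. \<alpha> \<in> multi_indices k \<and> length \<alpha> \<le> n \<and> Z \<in> K})"


section \<open>The spaces \<open>\<gg>\<^sub>k\<close> and \<open>\<GG>\<^sub>N\<close>\<close>

type_synonym 'd phase = "(real ^ 'd) \<times> (real ^ 'd)"
type_synonym 'd observable = "(nat \<Rightarrow> 'd phase) \<Rightarrow> real"

definition g_space :: "nat \<Rightarrow> 'd::finite observable set" where
  "g_space k = {f. smooth k f \<and> (\<forall>Z. Z \<notin> topspace (tuples k) \<longrightarrow> f Z = 0) \<and>
     (\<forall>\<sigma> Z. \<sigma> permutes {1..k} \<longrightarrow> Z \<in> topspace (tuples k) \<longrightarrow> f (Z \<circ> \<sigma>) = f Z)}"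

definition g_topology :: "nat \<Rightarrow> 'd::finite observable topology" where
  "g_topology k = seminorm_topology (g_space k)
     {smooth_seminorm k n K | n K. compactin (tuples k) K}"

definition g_bracket :: "nat \<Rightarrow> 'd::finite observable \<Rightarrow> 'd observable \<Rightarrow> 'd observable" where
  "g_bracket k f g Z = real k * (\<Sum>i=1..k. \<Sum>b\<in>Basis.
     partial (i, (b, 0)) f Z * partial (i, (0, b)) g Z - partial (i, (0, b)) f Z * partial (i, (b, 0)) g Z)"

definition P_set :: "nat \<Rightarrow> nat \<Rightarrow> (nat \<Rightarrow> nat) set" where
  "P_set k N = {j \<in> {1..k} \<rightarrow>\<^sub>E {1..N}. inj_on j {1..k}}"

definition eps :: "nat \<Rightarrow> nat \<Rightarrow> 'd::finite observable \<Rightarrow> 'd observable" where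
  "eps k N f Z = (if Z \<in> topspace (tuples N)
     then (\<Sum>j\<in>P_set k N. f (\<lambda>i\<in>{1..k}. Z (j i))) / real (card (P_set k N)) else 0)"

text \<open>Elements of the direct sum are extended by zero to indices outside \<open>{1..N}\<close>, whereas
  \<^const>\<open>product_topology\<close> lives on extensional functions; the two are identified by restriction.\<close>

definition G_space :: "nat \<Rightarrow> (nat \<Rightarrow> 'd::finite observable) set" where
  "G_space N = {F. (\<forall>k\<in>{1..N}. F k \<in> g_space k) \<and> (\<forall>k. k \<notin> {1..N} \<longrightarrow> F k = 0)}"

definition G_topology :: "nat \<Rightarrow> (nat \<Rightarrow> 'd::finite observable) topology" where
  "G_topology N = pullback_topology (G_space N) (\<lambda>F. restrict F {1..N})
     (product_topology g_topology {1..N})"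

definition G_bracket :: "nat \<Rightarrow> (nat \<Rightarrow> 'd::finite observable) \<Rightarrow> (nat \<Rightarrow> 'd observable) \<Rightarrow> nat \<Rightarrow> 'd observable" where
  "G_bracket N F G k = (if k \<in> {1..N}
     then inv_into (g_space k) (eps k N)
       (\<Sum>(l, j) \<in> {(l, j). l \<in> {1..N} \<and> j \<in> {1..N} \<and> min (l + j - 1) N = k}.
          g_bracket N (eps l N (F l)) (eps j N (G j)))
     else 0)"

end

(* A bracket of functions depending on l and j of the N points vanishes unless the two sets of points
   meet, and then depends on at most min(l+j-1, N) points; averaging over permutations of the points
   therefore puts [eps_l f, eps_j g] into the image of eps_k with k = min(l+j-1, N). Hence the bracket
   on sequences is transported from the Poisson bracket on functions of N points by the injective maps
   eps_k, and the Lie algebra identities are inherited from the Poisson bracket. For continuity one needs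
   that eps_k has a continuous left inverse: evaluating eps_k f at tuples with some points set to 0 gives
   a triangular system for the corresponding values of f. *)

theory Submission
  imports Defs
begin

section \<open>Topologies generated by seminorms\<close>

text \<open>The inheritance of the Lie identities is not an isomorphism argument. The images of the
  maps \<open>eps k N\<close> are nested, so a sequence is not determined by the sum of its embedded
  entries, and every identity has to be checked in each degree \<open>k\<close> separately. For the
  Jacobi identity this works because each of the two brackets subtracts one from the sum of the
  degrees: all three double brackets of entries of degrees \<open>l\<close>, \<open>a\<close>,
  \<open>b\<close> are counted in degree \<open>min (l + a + b - 2) N\<close>, which is symmetric in
  the three indices. A function of \<open>k\<close> points evaluated at one fixed selection of the
  \<open>N\<close> points is not symmetric. The calculus therefore lives in the larger spaces
  \<open>smooth_space k\<close>, and symmetry enters only through averages and through the left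
  inverse. The base point 0 of the left inverse is an arbitrary choice. The triangular system is
  indexed by the sets \<open>R\<close> of points left free, and \<open>R = {1..k}\<close> returns
  the function itself. Its solution is a finite combination of substitutions, hence continuous by
  direct seminorm estimates.\<close>

locale seminorm_family =
  fixes V :: "'a::real_vector set" and P :: "('a \<Rightarrow> real) set"
  assumes subspace: "subspace V"
    and nonempty: "P \<noteq> {}"
    and triangle: "p \<in> P \<Longrightarrow> x \<in> V \<Longrightarrow> y \<in> V \<Longrightarrow> p (x + y) \<le> p x + p y"
    and scale: "p \<in> P \<Longrightarrow> x \<in> V \<Longrightarrow> p (c *\<^sub>R x) = \<bar>c\<bar> * p x"
begin

abbreviation "T \<equiv> seminorm_topology V P"

lemma zero: "p \<in> P \<Longrightarrow> p 0 = 0"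
  using scale[of p 0 0] subspace_0[OF subspace] by simp

lemma minus: "p \<in> P \<Longrightarrow> x \<in> V \<Longrightarrow> p (- x) = p x"
  using scale[of p x "-1"] by simp

lemma minus_commute: "p \<in> P \<Longrightarrow> x \<in> V \<Longrightarrow> y \<in> V \<Longrightarrow> p (x - y) = p (y - x)"
  using minus[of p "x - y"] subspace_diff[OF subspace] by simp

lemma reverse_triangle: assumes "p \<in> P" "x \<in> V" "y \<in> V" shows "\<bar>p x - p y\<bar> \<le> p (x - y)"
  using triangle[OF assms(1) subspace_diff[OF subspace assms(2,3)] assms(3)]
    triangle[OF assms(1) subspace_diff[OF subspace assms(3,2)] assms(2)] minus_commute[OF assms]
  by simp

lemma topspace: "topspace T = V"
proof
  show "topspace T \<subseteq> V" unfolding seminorm_topology_def by auto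
  show "V \<subseteq> topspace T"
  proof
    fix x assume x: "x \<in> V"
    \<comment> \<open>With no seminorm at all there would be no balls, and the generated topology
      would have empty underlying set.\<close>
    obtain p where p: "p \<in> P" using nonempty by blast
    have "x \<in> {g \<in> V. p (g - x) < 1}" using x zero[OF p] by simp
    then show "x \<in> topspace T" unfolding seminorm_topology_def using p x
      by (auto intro!: exI[of _ "{g \<in> V. p (g - x) < 1}"] exI[of _ p] exI[of _ x] exI[of _ "1::real"])
  qed
qed

lemma openin_ball: "p \<in> P \<Longrightarrow> f \<in> V \<Longrightarrow> 0 < r \<Longrightarrow> openin T {g \<in> V. p (g - f) < r}"
  unfolding seminorm_topology_def openin_topology_generated_by_iff
  by (rule generate_topology_on.Basis) blast

text \<open>A real-valued majorant \<open>D\<close> replaces neighbourhoods: where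
  \<open>D x < r - p (f x0 - g)\<close>, the triangle inequality keeps \<open>f x\<close> in the
  ball of radius \<open>r\<close> about \<open>g\<close>. Later continuity proofs only have to
  exhibit such a \<open>D\<close>, usually a combination of seminorms of differences.\<close>

lemma continuous_into:
  assumes f: "\<And>x. x \<in> topspace X \<Longrightarrow> f x \<in> V"
    and D: "\<And>p x0. p \<in> P \<Longrightarrow> x0 \<in> topspace X \<Longrightarrow>
      \<exists>D. continuous_map X euclideanreal D \<and> D x0 = 0 \<and> (\<forall>x\<in>topspace X. p (f x - f x0) \<le> D x)"
  shows "continuous_map X T f"
  unfolding seminorm_topology_def
proof (rule continuous_on_generated_topo)
  fix U assume "U \<in> {{g \<in> V. p (g - f) < r} |p f r. p \<in> P \<and> f \<in> V \<and> 0 < r}"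
  then obtain p g r where U: "U = {h \<in> V. p (h - g) < r}" and p: "p \<in> P" and g: "g \<in> V" by blast
  show "openin X (f -` U \<inter> topspace X)"
  proof (subst openin_subopen, intro ballI)
    fix x0 assume x0: "x0 \<in> f -` U \<inter> topspace X"
    then obtain D where cD: "continuous_map X euclideanreal D" and D0: "D x0 = 0"
      and Dle: "\<And>x. x \<in> topspace X \<Longrightarrow> p (f x - f x0) \<le> D x"
      using D[OF p] by blast
    let ?W = "{x \<in> topspace X. D x \<in> {..<r - p (f x0 - g)}}"
    have "openin X ?W"
      by (rule openin_continuous_map_preimage[OF cD]) auto
    moreover have "x0 \<in> ?W" using x0 D0 U by auto
    moreover have "?W \<subseteq> f -` U \<inter> topspace X"
    proof
      fix x assume x: "x \<in> ?W"
      have "p (f x - g) \<le> p (f x - f x0) + p (f x0 - g)"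
        using triangle[OF p, of "f x - f x0" "f x0 - g"] x x0 f g subspace_diff[OF subspace]
        by auto
      then show "x \<in> f -` U \<inter> topspace X" using Dle[of x] x f U by auto
    qed
    ultimately show "\<exists>W. openin X W \<and> x0 \<in> W \<and> W \<subseteq> f -` U \<inter> topspace X" by blast
  qed
next
  have "f x \<in> \<Union> {{g \<in> V. p (g - f) < r} |p f r. p \<in> P \<and> f \<in> V \<and> 0 < r}" if "x \<in> topspace X" for x
    using f[OF that] topspace unfolding seminorm_topology_def topology_generated_by_topspace by blast
  then show "f ` topspace X \<subseteq> \<Union> {{g \<in> V. p (g - f) < r} |p f r. p \<in> P \<and> f \<in> V \<and> 0 < r}" by blast
qed

text \<open>The reverse triangle inequality bounds the variation of this function by
  \<open>p\<close> itself. Such functions are the building blocks of the majorants required by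
  \<open>continuous_into\<close>.\<close>

lemma continuous_seminorm_shift:
  assumes p: "p \<in> P" and a: "a \<in> V"
  shows "continuous_map T euclideanreal (\<lambda>x. p (x - a))"
proof -
  have "openin T {x \<in> V. p (x - a) \<in> U}" if U: "open U" for U
  proof (subst openin_subopen, intro ballI)
    fix x0 assume x0: "x0 \<in> {x \<in> V. p (x - a) \<in> U}"
    obtain e where e: "e > 0" "\<And>y. dist y (p (x0 - a)) < e \<Longrightarrow> y \<in> U"
      using x0 U open_dist by blast
    have "{x \<in> V. p (x - x0) < e} \<subseteq> {x \<in> V. p (x - a) \<in> U}"
    proof
      fix x assume x: "x \<in> {x \<in> V. p (x - x0) < e}"
      have "\<bar>p (x - a) - p (x0 - a)\<bar> \<le> p (x - x0)"
        using reverse_triangle[OF p, of "x - a" "x0 - a"] x x0 a subspace_diff[OF subspace] by simp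
      then show "x \<in> {x \<in> V. p (x - a) \<in> U}" using e x by (simp add: dist_real_def)
    qed
    moreover have "x0 \<in> {x \<in> V. p (x - x0) < e}" using x0 e zero[OF p] by simp
    ultimately show "\<exists>W. openin T W \<and> x0 \<in> W \<and> W \<subseteq> {x \<in> V. p (x - a) \<in> U}"
      using openin_ball[OF p _ e(1), of x0] x0 by blast
  qed
  then show ?thesis unfolding continuous_map_alt topspace
    by (auto simp: vimage_def Int_def conj_commute)
qed

lemma continuous_seminorm_diff:
  assumes "p \<in> P" and "a \<in> V" and "continuous_map X T f"
  shows "continuous_map X euclideanreal (\<lambda>x. p (f x - a))"
  using continuous_map_compose[OF assms(3) continuous_seminorm_shift[OF assms(1,2)]]
  by (simp add: comp_def)

lemma continuous_plus:
  assumes f: "continuous_map X T f" and g: "continuous_map X T g"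
  shows "continuous_map X T (\<lambda>x. f x + g x)"
proof (rule continuous_into)
  have fV: "f x \<in> V" and gV: "g x \<in> V" if "x \<in> topspace X" for x
    using continuous_map_image_subset_topspace[OF f] continuous_map_image_subset_topspace[OF g] that
      topspace by auto
  show "\<And>x. x \<in> topspace X \<Longrightarrow> f x + g x \<in> V" using fV gV subspace_add[OF subspace] by blast
  fix p x0 assume p: "p \<in> P" and x0: "x0 \<in> topspace X"
  let ?D = "\<lambda>x. p (f x - f x0) + p (g x - g x0)"
  have "continuous_map X euclideanreal ?D"
    by (intro continuous_map_add continuous_seminorm_diff p f g fV gV x0)
  moreover have "p (f x + g x - (f x0 + g x0)) \<le> ?D x" if "x \<in> topspace X" for x
    using triangle[OF p, of "f x - f x0" "g x - g x0"] fV gV that x0 subspace_diff[OF subspace]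
    by (simp add: algebra_simps)
  ultimately show "\<exists>D. continuous_map X euclideanreal D \<and> D x0 = 0 \<and>
      (\<forall>x\<in>topspace X. p (f x + g x - (f x0 + g x0)) \<le> D x)"
    using zero[OF p] by (intro exI[of _ ?D]) simp
qed

lemma continuous_scaled:
  assumes c: "continuous_map X euclideanreal c" and f: "continuous_map X T f"
  shows "continuous_map X T (\<lambda>x. c x *\<^sub>R f x)"
proof (rule continuous_into)
  have fV: "f x \<in> V" if "x \<in> topspace X" for x
    using continuous_map_image_subset_topspace[OF f] that topspace by auto
  show "\<And>x. x \<in> topspace X \<Longrightarrow> c x *\<^sub>R f x \<in> V" using fV subspace_scale[OF subspace] by blast
  fix p x0 assume p: "p \<in> P" and x0: "x0 \<in> topspace X"
  let ?D = "\<lambda>x. \<bar>c x\<bar> * p (f x - f x0) + \<bar>c x - c x0\<bar> * p (f x0)"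
  have "continuous_map X euclideanreal ?D"
    by (intro continuous_intros continuous_seminorm_diff p f c fV x0)
  moreover have "p (c x *\<^sub>R f x - c x0 *\<^sub>R f x0) \<le> ?D x" if x: "x \<in> topspace X" for x
  proof -
    have eq: "c x *\<^sub>R f x - c x0 *\<^sub>R f x0 = c x *\<^sub>R (f x - f x0) + (c x - c x0) *\<^sub>R f x0"
      by (simp add: algebra_simps)
    show ?thesis unfolding eq
      using triangle[OF p, of "c x *\<^sub>R (f x - f x0)" "(c x - c x0) *\<^sub>R f x0"] fV x x0
        subspace_diff[OF subspace] subspace_scale[OF subspace] scale[OF p] by simp
  qed
  ultimately show "\<exists>D. continuous_map X euclideanreal D \<and> D x0 = 0 \<and>
      (\<forall>x\<in>topspace X. p (c x *\<^sub>R f x - c x0 *\<^sub>R f x0) \<le> D x)"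
    using zero[OF p] by (intro exI[of _ ?D]) simp
qed

lemma continuous_sum:
  assumes "\<And>i. i \<in> I \<Longrightarrow> continuous_map X T (f i)"
  shows "continuous_map X T (\<lambda>x. \<Sum>i\<in>I. f i x)"
proof (cases "finite I")
  case True
  then show ?thesis using assms
    by (induction I rule: finite_induct) 
      (auto simp: topspace subspace_0[OF subspace] intro: continuous_plus)
qed (simp add: topspace subspace_0[OF subspace])

lemma continuous_diff:
  assumes "continuous_map X T f" and "continuous_map X T g"
  shows "continuous_map X T (\<lambda>x. f x - g x)"
  using continuous_plus[OF assms(1) continuous_scaled[of X "\<lambda>_. -1" g]] assms(2) by simp

lemma convex_ball: assumes p: "p \<in> P" and f: "f \<in> V" shows "convex {g \<in> V. p (g - f) < r}"
proof (rule convexI)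
  fix x y and u v :: real
  assume x: "x \<in> {g \<in> V. p (g - f) < r}" and y: "y \<in> {g \<in> V. p (g - f) < r}"
    and uv: "0 \<le> u" "0 \<le> v" "u + v = 1"
  have "u *\<^sub>R x + v *\<^sub>R y - f = u *\<^sub>R x + v *\<^sub>R y - (u + v) *\<^sub>R f" using uv by simp
  also have "\<dots> = u *\<^sub>R (x - f) + v *\<^sub>R (y - f)" by (simp add: algebra_simps)
  finally have eq: "u *\<^sub>R x + v *\<^sub>R y - f = u *\<^sub>R (x - f) + v *\<^sub>R (y - f)" .
  have "p (u *\<^sub>R (x - f) + v *\<^sub>R (y - f)) \<le> u * p (x - f) + v * p (y - f)"
    using triangle[OF p, of "u *\<^sub>R (x - f)" "v *\<^sub>R (y - f)"] scale[OF p] x y f uv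
      subspace_diff[OF subspace] subspace_scale[OF subspace] by simp
  also have "\<dots> < r" using convex_bound_lt[of "p (x - f)" r "p (y - f)" u v] x y uv by simp
  finally show "u *\<^sub>R x + v *\<^sub>R y \<in> {g \<in> V. p (g - f) < r}"
    using x y eq subspace_add[OF subspace] subspace_scale[OF subspace] by simp
qed

text \<open>Induction on the generation of \<open>U\<close>: balls and intersections of convex sets
  are convex, and a point of a union already lies in one member. A ball need not be centred at
  \<open>x\<close>; it is taken as a whole.\<close>

lemma convex_neighbourhood:
  assumes "openin T U" "x \<in> U"
  shows "\<exists>C. openin T C \<and> convex C \<and> x \<in> C \<and> C \<subseteq> U"
proof -
  let ?S = "{{g \<in> V. p (g - f) < r} |p f r. p \<in> P \<and> f \<in> V \<and> 0 < r}"
  have "generate_topology_on ?S U"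
    using assms(1) unfolding seminorm_topology_def openin_topology_generated_by_iff .
  then show ?thesis using assms(2)
  proof (induction arbitrary: x rule: generate_topology_on.induct)
    case Empty
    then show ?case by simp
  next
    case (Int a b)
    then obtain C D where "openin T C \<and> convex C \<and> x \<in> C \<and> C \<subseteq> a"
      and "openin T D \<and> convex D \<and> x \<in> D \<and> D \<subseteq> b" by (meson IntE)
    then show ?case by (intro exI[of _ "C \<inter> D"]) (auto intro: openin_Int convex_Int)
  next
    case (UN K)
    then show ?case by (meson Sup_upper UnionE subset_trans)
  next
    case (Basis s)
    then show ?case using convex_ball openin_ball by (intro exI[of _ s]) auto
  qed
qed

lemma locally_convex: "locally_convex_space V T"
proof
  show "continuous_map (prod_topology T T) T (\<lambda>(x, y). x + y)"
    unfolding case_prod_beta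
    by (intro continuous_plus continuous_map_fst continuous_map_snd)
  show "continuous_map (prod_topology euclideanreal T) T (\<lambda>(c, x). c *\<^sub>R x)"
    unfolding case_prod_beta
    by (intro continuous_scaled continuous_map_fst continuous_map_snd)
qed (use subspace topspace convex_neighbourhood in auto)

lemma sub_family: "subspace W \<Longrightarrow> W \<subseteq> V \<Longrightarrow> seminorm_family W P"
  by unfold_locales (use nonempty triangle scale in blast)+

text \<open>\<open>g_topology k\<close> is generated by the seminorms on \<open>g_space k\<close>
  and is not defined as a subspace topology. Together with \<open>continuous_inclusion\<close> this
  allows passing between it and the topology of all smooth functions: differences of points of
  \<open>W\<close> have the same seminorms in both.\<close>

lemma continuous_into_subspace:
  assumes W: "subspace W" "W \<subseteq> V" and f: "continuous_map X T f"
    and fW: "\<And>x. x \<in> topspace X \<Longrightarrow> f x \<in> W"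
  shows "continuous_map X (seminorm_topology W P) f"
proof (rule seminorm_family.continuous_into[OF sub_family[OF W] fW])
  fix p x0 assume p: "p \<in> P" and x0: "x0 \<in> topspace X"
  show "\<exists>D. continuous_map X euclideanreal D \<and> D x0 = 0 \<and>
      (\<forall>x\<in>topspace X. p (f x - f x0) \<le> D x)"
    using continuous_seminorm_diff[OF p _ f, of "f x0"] fW[OF x0] W zero[OF p]
    by (intro exI[of _ "\<lambda>x. p (f x - f x0)"]) auto
qed

lemma continuous_inclusion:
  assumes W: "subspace W" "W \<subseteq> V"
  shows "continuous_map (seminorm_topology W P) T (\<lambda>x. x)"
proof (rule continuous_into)
  interpret W: seminorm_family W P by (rule sub_family[OF W])
  show "\<And>x. x \<in> topspace W.T \<Longrightarrow> x \<in> V" using W W.topspace by auto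
  fix p x0 assume p: "p \<in> P" and x0: "x0 \<in> topspace W.T"
  show "\<exists>D. continuous_map W.T euclideanreal D \<and> D x0 = 0 \<and> (\<forall>x\<in>topspace W.T. p (x - x0) \<le> D x)"
    using W.continuous_seminorm_diff[OF p _ continuous_map_id, of x0] x0 W.topspace zero[OF p]
    by (intro exI[of _ "\<lambda>x. p (x - x0)"]) auto
qed

end

text \<open>The simplifier would use these pointwise rules extensionally and turn \<open>f + g\<close> into an abstraction.\<close>

declare plus_fun_apply [simp del] times_fun_apply [simp del] zero_fun_apply [simp del] minus_apply [simp del]

declare One_nat_def [simp del] topspace_product_topology [simp del]

section \<open>Calculus of smooth functions\<close>

lemma topspace_tuples: "topspace (tuples k) = extensional {1..k}"
  by (auto simp: topspace_product_topology PiE_iff extensional_def)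

lemma update_in_tuples: "i \<in> {1..k} \<Longrightarrow> Z(i := x) \<in> topspace (tuples k) \<longleftrightarrow> Z \<in> topspace (tuples k)"
  unfolding topspace_tuples by (auto simp: extensional_def)

lemma partials_Nil [simp]: "partials [] f = f"
  and partials_Cons [simp]: "partials (a # \<alpha>) f = partial a (partials \<alpha> f)"
  and partials_append [simp]: "partials (\<alpha> @ \<beta>) f = partials \<alpha> (partials \<beta> f)"
  by (simp_all add: partials_def)

text \<open>Invariance under permutations is left out: a function evaluated at a single selection of
  points, a partial derivative or a term of the bracket is smooth but in general not
  symmetric.\<close>

definition smooth_space :: "nat \<Rightarrow> ((nat \<Rightarrow> 'z::euclidean_space) \<Rightarrow> real) set" where
  "smooth_space k = {f. smooth k f \<and> (\<forall>Z. Z \<notin> topspace (tuples k) \<longrightarrow> f Z = 0)}"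

lemma smooth_space_continuous: "f \<in> smooth_space k \<Longrightarrow> continuous_map (tuples k) euclideanreal f"
  unfolding smooth_space_def smooth_def multi_indices_def by (force dest!: bspec[of _ _ "[]"])

lemma smooth_space_off: "f \<in> smooth_space k \<Longrightarrow> Z \<notin> topspace (tuples k) \<Longrightarrow> f Z = 0"
  unfolding smooth_space_def by blast

text \<open>Moving a coordinate in \<open>{1..k}\<close> never enters or leaves the tuple space, and
  \<open>f\<close> vanishes off it. Hence \<open>Z\<close> is unrestricted, and the rules for
  \<open>partial\<close> below become equations between functions.\<close>

lemma smooth_space_differentiable:
  assumes f: "f \<in> smooth_space k" and i: "i \<in> {1..k}" "u \<in> Basis"
  shows "(\<lambda>t. f (Z(i := Z i + t *\<^sub>R u))) differentiable (at (0::real))"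
proof (cases "Z \<in> topspace (tuples k)")
  case True
  have "[] \<in> multi_indices k" by (simp add: multi_indices_def)
  then show ?thesis using f i True unfolding smooth_space_def smooth_def by fastforce
next
  case False
  then have "(\<lambda>t. f (Z(i := Z i + t *\<^sub>R u))) = (\<lambda>t. 0)"
    using smooth_space_off[OF f] update_in_tuples[OF i(1), of Z] by blast
  then show ?thesis by simp
qed

lemma smooth_space_partial:
  assumes f: "f \<in> smooth_space k" and a: "a \<in> {1..k} \<times> Basis"
  shows "partial a f \<in> smooth_space k"
proof -
  obtain i u where iu: "a = (i, u)" "i \<in> {1..k}" "u \<in> Basis" using a by blast
  have "smooth k (partial a f)"
    unfolding smooth_def
  proof
    fix \<alpha> assume "\<alpha> \<in> (multi_indices k :: (nat \<times> 'a) list set)"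
    then have "\<alpha> @ [a] \<in> multi_indices k" using a by (simp add: multi_indices_def)
    then show "continuous_map (tuples k) euclideanreal (partials \<alpha> (partial a f)) \<and>
       (\<forall>i \<in> {1..k}. \<forall>u \<in> Basis. \<forall>Z \<in> topspace (tuples k).
        (\<lambda>t. partials \<alpha> (partial a f) (Z(i := Z i + t *\<^sub>R u))) differentiable (at 0))"
      using f unfolding smooth_space_def smooth_def by fastforce
  qed
  moreover have "partial a f Z = 0" if Z: "Z \<notin> topspace (tuples k)" for Z
  proof -
    have "(\<lambda>t. f (Z(i := Z i + t *\<^sub>R u))) = (\<lambda>t. 0)"
      using smooth_space_off[OF f] update_in_tuples[OF iu(2), of Z] Z by blast
    then show ?thesis by (simp add: partial_def iu)
  qed
  ultimately show ?thesis unfolding smooth_space_def by blast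
qed

text \<open>Smoothness is the largest property that implies continuity and differentiability in the
  coordinates and is inherited by partial derivatives. It thus suffices to place a function in some
  family \<open>X\<close> closed under \<open>partial\<close>, without computing iterated
  derivatives.\<close>

lemma smooth_space_coinduct:
  assumes f: "f \<in> X"
    and cont: "\<And>g. g \<in> X \<Longrightarrow> continuous_map (tuples k) euclideanreal g"
    and off: "\<And>g Z. g \<in> X \<Longrightarrow> Z \<notin> topspace (tuples k) \<Longrightarrow> g Z = 0"
    and diff: "\<And>g i u Z. g \<in> X \<Longrightarrow> i \<in> {1..k} \<Longrightarrow> u \<in> Basis \<Longrightarrow> Z \<in> topspace (tuples k) \<Longrightarrow>
      (\<lambda>t. g (Z(i := Z i + t *\<^sub>R u))) differentiable (at 0)"
    and closed: "\<And>g i u. g \<in> X \<Longrightarrow> i \<in> {1..k} \<Longrightarrow> u \<in> Basis \<Longrightarrow> partial (i, u) g \<in> X"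
  shows "f \<in> smooth_space k"
proof -
  have "partials \<alpha> f \<in> X" if "\<alpha> \<in> multi_indices k" for \<alpha>
    using that
  proof (induction \<alpha>)
    case (Cons a \<alpha>)
    then obtain i u where "a = (i, u)" "i \<in> {1..k}" "u \<in> Basis" "\<alpha> \<in> multi_indices k"
      by (auto simp: multi_indices_def)
    then show ?case using Cons.IH closed by simp
  qed (simp add: f)
  then show ?thesis unfolding smooth_space_def smooth_def using cont off diff f by blast
qed

text \<open>The line through \<open>Z\<close> at parameter \<open>s\<close> is the line through the
  shifted point at parameter 0, so differentiability at 0 for every base point gives it along the
  whole line. The mean value theorem needs this form.\<close>

lemma has_derivative_partial:
  assumes f: "f \<in> smooth_space k" and i: "i \<in> {1..k}" "u \<in> Basis"
  shows "((\<lambda>t. f (Z(i := Z i + t *\<^sub>R u))) has_real_derivative partial (i, u) f (Z(i := Z i + s *\<^sub>R u))) (at s)"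
proof -
  let ?Z = "Z(i := Z i + s *\<^sub>R u)"
  have "((\<lambda>t. f (?Z(i := ?Z i + t *\<^sub>R u))) has_real_derivative partial (i, u) f ?Z) (at (s - s))"
    using smooth_space_differentiable[OF f i, of ?Z] unfolding partial_def
    by (simp add: DERIV_deriv_iff_real_differentiable)
  then have "((\<lambda>t. f (?Z(i := ?Z i + (t - s) *\<^sub>R u))) has_real_derivative partial (i, u) f ?Z * 1) (at s)"
    by (rule DERIV_chain2) (auto intro!: derivative_eq_intros)
  then show ?thesis by (simp add: algebra_simps)
qed

lemma has_derivative_partial_0:
  assumes "f \<in> smooth_space k" and "i \<in> {1..k}" "u \<in> Basis"
  shows "((\<lambda>t. f (Z(i := Z i + t *\<^sub>R u))) has_real_derivative partial (i, u) f Z) (at 0)"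
  using has_derivative_partial[OF assms, of Z 0] by simp

lemma partial_eqI:
  "((\<lambda>t. f (Z(i := Z i + t *\<^sub>R u))) has_real_derivative D) (at 0) \<Longrightarrow> partial (i, u) f Z = D"
  unfolding partial_def by (simp add: DERIV_imp_deriv)

text \<open>The polynomial algebra over the smooth functions is closed under partial derivatives, hence
  consists of smooth functions.\<close>

inductive_set polys :: "nat \<Rightarrow> ((nat \<Rightarrow> 'z::euclidean_space) \<Rightarrow> real) set" for k where
  base: "f \<in> smooth_space k \<Longrightarrow> f \<in> polys k"
| zero: "0 \<in> polys k"
| add: "f \<in> polys k \<Longrightarrow> g \<in> polys k \<Longrightarrow> f + g \<in> polys k"
| scale: "f \<in> polys k \<Longrightarrow> c *\<^sub>R f \<in> polys k"
| mult: "f \<in> polys k \<Longrightarrow> g \<in> polys k \<Longrightarrow> f * g \<in> polys k"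

lemma polys_continuous: "f \<in> polys k \<Longrightarrow> continuous_map (tuples k) euclideanreal f"
proof (induction rule: polys.induct)
  case (base f)
  then show ?case by (rule smooth_space_continuous)
qed (auto simp: plus_fun_def times_fun_def scaleR_fun_def zero_fun_def
      intro!: continuous_map_add continuous_map_real_mult)

lemma polys_off: "f \<in> polys k \<Longrightarrow> Z \<notin> topspace (tuples k) \<Longrightarrow> f Z = 0"
  by (induction rule: polys.induct) (auto simp: scaleR_fun_def plus_fun_apply times_fun_apply zero_fun_apply smooth_space_off)

text \<open>The sum and product rules yield existence and value of the derivative in one induction,
  within the algebra, before anything is known about \<open>partial\<close> on products. One
  \<open>D\<close> has to serve all \<open>Z\<close>; for an \<open>a\<close> that is no coordinate
  the claim is vacuous.\<close>

lemma polys_derivative: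
  assumes "f \<in> polys k"
  shows "\<exists>D\<in>polys k. \<forall>i u. \<forall>Z. a = (i, u) \<longrightarrow> i \<in> {1..k} \<longrightarrow> u \<in> Basis \<longrightarrow>
    ((\<lambda>t. f (Z(i := Z i + t *\<^sub>R u))) has_real_derivative D Z) (at 0)"
  using assms
proof (induction rule: polys.induct)
  case (base f)
  show ?case
  proof (cases "a \<in> {1..k} \<times> Basis")
    case True
    have "partial a f \<in> polys k" by (intro polys.base smooth_space_partial base True)
    then show ?thesis
      by (intro bexI[of _ "partial a f"] allI impI) (use has_derivative_partial_0[OF base] in blast)+
  qed (use polys.zero in blast)
next
  case zero
  show ?case by (intro bexI[of _ 0]) (auto simp: zero_fun_def polys.zero[unfolded zero_fun_def])
next
  case (add f g)
  then obtain D E where "D \<in> polys k" "E \<in> polys k"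
    "\<forall>i u Z. a = (i, u) \<longrightarrow> i \<in> {1..k} \<longrightarrow> u \<in> Basis \<longrightarrow>
      ((\<lambda>t. f (Z(i := Z i + t *\<^sub>R u))) has_real_derivative D Z) (at 0)"
    "\<forall>i u Z. a = (i, u) \<longrightarrow> i \<in> {1..k} \<longrightarrow> u \<in> Basis \<longrightarrow>
      ((\<lambda>t. g (Z(i := Z i + t *\<^sub>R u))) has_real_derivative E Z) (at 0)" by blast
  then show ?case
    by (intro bexI[of _ "D + E"] polys.add allI impI) (simp_all add: plus_fun_apply DERIV_add del: fun_upd_apply)
next
  case (scale f c)
  then obtain D where "D \<in> polys k"
    "\<forall>i u Z. a = (i, u) \<longrightarrow> i \<in> {1..k} \<longrightarrow> u \<in> Basis \<longrightarrow>
      ((\<lambda>t. f (Z(i := Z i + t *\<^sub>R u))) has_real_derivative D Z) (at 0)" by blast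
  then show ?case
    by (intro bexI[of _ "c *\<^sub>R D"] polys.scale allI impI)
      (simp_all add: scaleR_fun_def DERIV_cmult del: fun_upd_apply)
next
  case (mult f g)
  then obtain D E where DE: "D \<in> polys k" "E \<in> polys k"
    "\<forall>i u Z. a = (i, u) \<longrightarrow> i \<in> {1..k} \<longrightarrow> u \<in> Basis \<longrightarrow>
      ((\<lambda>t. f (Z(i := Z i + t *\<^sub>R u))) has_real_derivative D Z) (at 0)"
    "\<forall>i u Z. a = (i, u) \<longrightarrow> i \<in> {1..k} \<longrightarrow> u \<in> Basis \<longrightarrow>
      ((\<lambda>t. g (Z(i := Z i + t *\<^sub>R u))) has_real_derivative E Z) (at 0)" by blast
  show ?case
  proof (intro bexI[of _ "D * g + E * f"] allI impI)
    fix i u Z assume iu: "a = (i, u)" "i \<in> {1..k}" "u \<in> Basis"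
    have "((\<lambda>t. f (Z(i := Z i + t *\<^sub>R u))) has_real_derivative D Z) (at 0)"
      "((\<lambda>t. g (Z(i := Z i + t *\<^sub>R u))) has_real_derivative E Z) (at 0)"
      using DE(3,4) iu by blast+
    from DERIV_mult[OF this]
    show "((\<lambda>t. (f * g) (Z(i := Z i + t *\<^sub>R u))) has_real_derivative (D * g + E * f) Z) (at 0)"
      by (simp add: plus_fun_apply times_fun_apply)
  qed (intro polys.add polys.mult mult DE)
qed

lemma polys_eq: "polys k = smooth_space k"
proof
  show "polys k \<subseteq> (smooth_space k :: ((nat \<Rightarrow> 'a) \<Rightarrow> real) set)"
  proof (rule subsetI, erule smooth_space_coinduct)
    fix f :: "(nat \<Rightarrow> 'a) \<Rightarrow> real" and i and u :: 'a assume a: "f \<in> polys k" "i \<in> {1..k}" "u \<in> Basis"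
    then obtain D where D: "D \<in> polys k"
      "\<And>Z. ((\<lambda>t. f (Z(i := Z i + t *\<^sub>R u))) has_real_derivative D Z) (at 0)"
      using polys_derivative[of f k "(i, u)"] by blast
    then have "partial (i, u) f = D" using partial_eqI by blast
    then show "partial (i, u) f \<in> polys k" using D by simp
    show "(\<lambda>t. f (Z(i := Z i + t *\<^sub>R u))) differentiable at 0" for Z
      using D(2) real_differentiable_def by blast
  qed (fact polys_continuous polys_off)+
qed (auto intro: polys.base)

lemma subspace_smooth_space: "subspace (smooth_space k)"
  using polys.zero polys.add polys.scale unfolding polys_eq subspace_def by blast

lemma smooth_space_mult: "f \<in> smooth_space k \<Longrightarrow> g \<in> smooth_space k \<Longrightarrow> f * g \<in> smooth_space k"
  using polys.mult unfolding polys_eq .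

lemmas smooth_space_0 = subspace_0[OF subspace_smooth_space]
  and smooth_space_add = subspace_add[OF subspace_smooth_space]
  and smooth_space_diff = subspace_diff[OF subspace_smooth_space]
  and smooth_space_scale = subspace_scale[OF subspace_smooth_space]
  and smooth_space_sum = subspace_sum[OF subspace_smooth_space]

lemma partial_add:
  assumes "f \<in> smooth_space k" "g \<in> smooth_space k" "a \<in> {1..k} \<times> Basis"
  shows "partial a (f + g) = partial a f + partial a g"
proof -
  obtain i u where iu: "a = (i, u)" "i \<in> {1..k}" "u \<in> Basis" using assms by blast
  show ?thesis unfolding iu(1)
    by (rule ext, rule partial_eqI)
      (auto simp: plus_fun_apply intro!: derivative_eq_intros has_derivative_partial_0 assms iu)
qed

lemma partial_scale:
  assumes "f \<in> smooth_space k" "a \<in> {1..k} \<times> Basis"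
  shows "partial a (c *\<^sub>R f) = c *\<^sub>R partial a f"
proof -
  obtain i u where iu: "a = (i, u)" "i \<in> {1..k}" "u \<in> Basis" using assms by blast
  show ?thesis unfolding iu(1)
    by (rule ext, rule partial_eqI)
      (auto simp: scaleR_fun_def intro!: DERIV_cmult has_derivative_partial_0 assms iu)
qed

lemma partial_zero: "partial a 0 = 0"
  by (cases a) (auto simp: partial_def zero_fun_def)

lemma partial_diff:
  assumes "f \<in> smooth_space k" "g \<in> smooth_space k" "a \<in> {1..k} \<times> Basis"
  shows "partial a (f - g) = partial a f - partial a g"
  using partial_add[OF assms(1) smooth_space_scale[OF assms(2), of "-1"] assms(3)]
    partial_scale[OF assms(2,3), of "-1"] by simp

lemma partial_sum:
  assumes "\<And>i. i \<in> I \<Longrightarrow> f i \<in> smooth_space k" "a \<in> {1..k} \<times> Basis"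
  shows "partial a (\<Sum>i\<in>I. f i) = (\<Sum>i\<in>I. partial a (f i))"
  using assms(1)
proof (induction I rule: infinite_finite_induct)
  case (insert i I)
  then show ?case
    using partial_add[OF _ _ assms(2), of "f i" "sum f I"] smooth_space_sum[of I f k] by simp
qed (auto simp: partial_zero)

lemma partial_mult:
  assumes "f \<in> smooth_space k" "g \<in> smooth_space k" "a \<in> {1..k} \<times> Basis"
  shows "partial a (f * g) = partial a f * g + f * partial a g"
proof -
  obtain i u where iu: "a = (i, u)" "i \<in> {1..k}" "u \<in> Basis" using assms by blast
  show ?thesis unfolding iu(1)
  proof (rule ext, rule partial_eqI)
    fix Z
    show "((\<lambda>t. (f * g) (Z(i := Z i + t *\<^sub>R u))) has_real_derivative
         (partial (i, u) f * g + f * partial (i, u) g) Z) (at 0)"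
      using DERIV_mult[OF has_derivative_partial_0[OF assms(1) iu(2,3)]
          has_derivative_partial_0[OF assms(2) iu(2,3)], of Z]
      by (simp add: plus_fun_apply times_fun_apply algebra_simps)
  qed
qed

lemma smooth_space_partials: "f \<in> smooth_space k \<Longrightarrow> \<alpha> \<in> multi_indices k \<Longrightarrow> partials \<alpha> f \<in> smooth_space k"
  by (induction \<alpha>) (auto simp: multi_indices_def smooth_space_partial)

lemma partials_add:
  assumes "f \<in> smooth_space k" "g \<in> smooth_space k" "\<alpha> \<in> multi_indices k"
  shows "partials \<alpha> (f + g) = partials \<alpha> f + partials \<alpha> g"
  using assms(3)
proof (induction \<alpha>)
  case (Cons a \<alpha>)
  then have "a \<in> {1..k} \<times> Basis" "\<alpha> \<in> multi_indices k" by (auto simp: multi_indices_def)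
  then show ?case using Cons.IH assms(1,2) by (simp add: partial_add[of _ k] smooth_space_partials)
qed simp

lemma partials_scale:
  assumes "f \<in> smooth_space k" "\<alpha> \<in> multi_indices k"
  shows "partials \<alpha> (c *\<^sub>R f) = c *\<^sub>R partials \<alpha> f"
  using assms(2)
proof (induction \<alpha>)
  case (Cons a \<alpha>)
  then have "a \<in> {1..k} \<times> Basis" "\<alpha> \<in> multi_indices k" by (auto simp: multi_indices_def)
  then show ?case using Cons.IH assms(1) by (simp add: partial_scale[of _ k] smooth_space_partials)
qed simp

subsection \<open>The seminorms\<close>

definition smooth_seminorms :: "nat \<Rightarrow> (((nat \<Rightarrow> 'z::euclidean_space) \<Rightarrow> real) \<Rightarrow> real) set" where
  "smooth_seminorms k = {smooth_seminorm k n K | n K. compactin (tuples k) K}"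

text \<open>Only finitely many lists of length at most \<open>n\<close> exist over the finite set of
  coordinates, and each \<open>partials \<alpha> f\<close> is continuous, hence bounded on
  \<open>K\<close>. Without this bound the real \<open>Sup\<close> in \<open>smooth_seminorm\<close>
  would carry no information.\<close>

lemma bdd_above_smooth_seminorm:
  assumes f: "f \<in> smooth_space k" and K: "compactin (tuples k) K"
  shows "bdd_above (insert 0 {\<bar>partials \<alpha> f Z\<bar> | \<alpha> Z. \<alpha> \<in> multi_indices k \<and> length \<alpha> \<le> n \<and> Z \<in> K})"
proof -
  let ?A = "{\<alpha>. \<alpha> \<in> multi_indices k \<and> length \<alpha> \<le> n} :: (nat \<times> 'a) list set"
  have fin: "finite ?A"
    using finite_lists_length_le[of "{1..k} \<times> (Basis :: 'a set)" n]
    by (auto simp: multi_indices_def lists_eq_set)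
  have "bdd_above ((\<lambda>Z. \<bar>partials \<alpha> f Z\<bar>) ` K)" if "\<alpha> \<in> multi_indices k" for \<alpha>
  proof -
    have "compact (partials \<alpha> f ` K)"
      using image_compactin[OF K smooth_space_continuous[OF smooth_space_partials[OF f that]]]
      by simp
    then obtain B where "\<forall>x\<in>partials \<alpha> f ` K. \<bar>x\<bar> \<le> B"
      using compact_imp_bounded bounded_real by meson
    then show ?thesis by (intro bdd_aboveI[of _ B]) auto
  qed
  then have "bdd_above (\<Union>\<alpha>\<in>?A. (\<lambda>Z. \<bar>partials \<alpha> f Z\<bar>) ` K)"
    using bdd_above_UN[OF fin, of "\<lambda>\<alpha>. (\<lambda>Z. \<bar>partials \<alpha> f Z\<bar>) ` K"] by auto
  moreover have "(\<Union>\<alpha>\<in>?A. (\<lambda>Z. \<bar>partials \<alpha> f Z\<bar>) ` K) =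
      {\<bar>partials \<alpha> f Z\<bar> | \<alpha> Z. \<alpha> \<in> multi_indices k \<and> length \<alpha> \<le> n \<and> Z \<in> K}" by auto
  ultimately show ?thesis by simp
qed

lemma le_smooth_seminorm:
  assumes "f \<in> smooth_space k" "compactin (tuples k) K" "\<alpha> \<in> multi_indices k" "length \<alpha> \<le> n" "Z \<in> K"
  shows "\<bar>partials \<alpha> f Z\<bar> \<le> smooth_seminorm k n K f"
  unfolding smooth_seminorm_def
  by (rule cSup_upper[OF _ bdd_above_smooth_seminorm[OF assms(1,2)]]) (use assms in auto)

lemma smooth_seminorm_nonneg:
  assumes "f \<in> smooth_space k" "compactin (tuples k) K"
  shows "0 \<le> smooth_seminorm k n K f"
  unfolding smooth_seminorm_def
  by (rule cSup_upper[OF _ bdd_above_smooth_seminorm[OF assms(1,2)]]) auto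

lemma smooth_seminorm_le:
  assumes "0 \<le> c" "\<And>\<alpha> Z. \<alpha> \<in> multi_indices k \<Longrightarrow> length \<alpha> \<le> n \<Longrightarrow> Z \<in> K \<Longrightarrow> \<bar>partials \<alpha> f Z\<bar> \<le> c"
  shows "smooth_seminorm k n K f \<le> c"
  unfolding smooth_seminorm_def by (rule cSup_least) (use assms in auto)

lemma scaleR_fun_apply: "(c *\<^sub>R f) x = c *\<^sub>R f x"
  by (simp add: scaleR_fun_def)

lemma smooth_seminorm_scale_le:
  assumes f: "f \<in> smooth_space k" and K: "compactin (tuples k) K"
  shows "smooth_seminorm k n K (c *\<^sub>R f) \<le> \<bar>c\<bar> * smooth_seminorm k n K f"
  using le_smooth_seminorm[OF assms] smooth_seminorm_nonneg[OF assms] f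
  by (intro smooth_seminorm_le) (auto simp: partials_scale[OF f] scaleR_fun_apply abs_mult intro!: mult_left_mono)


interpretation smooth: seminorm_family "smooth_space k :: ((nat \<Rightarrow> 'z::euclidean_space) \<Rightarrow> real) set" "smooth_seminorms k"
proof
  show "subspace (smooth_space k)" by (rule subspace_smooth_space)
  show "smooth_seminorms k \<noteq> {}" unfolding smooth_seminorms_def using compactin_empty by blast
next
  fix p :: "((nat \<Rightarrow> 'z) \<Rightarrow> real) \<Rightarrow> real" and f g :: "(nat \<Rightarrow> 'z) \<Rightarrow> real"
  assume p: "p \<in> smooth_seminorms k" and f: "f \<in> smooth_space k" and g: "g \<in> smooth_space k"
  obtain n K where p_eq: "p = smooth_seminorm k n K" and K: "compactin (tuples k) K"
    using p unfolding smooth_seminorms_def by blast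
  show "p (f + g) \<le> p f + p g" unfolding p_eq
  proof (rule smooth_seminorm_le)
    show "0 \<le> smooth_seminorm k n K f + smooth_seminorm k n K g"
      using smooth_seminorm_nonneg[OF _ K] f g by (simp add: add_nonneg_nonneg)
    fix \<alpha> Z assume a: "\<alpha> \<in> (multi_indices k :: (nat \<times> 'z) list set)" "length \<alpha> \<le> n" "Z \<in> K"
    show "\<bar>partials \<alpha> (f + g) Z\<bar> \<le> smooth_seminorm k n K f + smooth_seminorm k n K g"
      using le_smooth_seminorm[OF f K a] le_smooth_seminorm[OF g K a] partials_add[OF f g a(1)]
      by (simp add: plus_fun_apply)
  qed
next
  fix p :: "((nat \<Rightarrow> 'z) \<Rightarrow> real) \<Rightarrow> real" and f :: "(nat \<Rightarrow> 'z) \<Rightarrow> real" and c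
  assume p: "p \<in> smooth_seminorms k" and f: "f \<in> smooth_space k"
  obtain n K where p_eq: "p = smooth_seminorm k n K" and K: "compactin (tuples k) K"
    using p unfolding smooth_seminorms_def by blast
  show "p (c *\<^sub>R f) = \<bar>c\<bar> * p f"
  proof (cases "c = 0")
    case True
    then show ?thesis using smooth_seminorm_scale_le[OF f K, of n 0]
        smooth_seminorm_nonneg[OF smooth_space_scale[OF f] K, of n 0] p_eq by simp
  next
    case False
    \<comment> \<open>The reverse inequality is the one already known, applied to
      \<open>c *\<^sub>R f\<close> and the factor \<open>inverse c\<close>.\<close>
    have "p f \<le> \<bar>inverse c\<bar> * p (c *\<^sub>R f)"
      using smooth_seminorm_scale_le[OF smooth_space_scale[OF f, of c] K, of n "inverse c"] False p_eq
      by simp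
    then have "\<bar>c\<bar> * p f \<le> p (c *\<^sub>R f)" using False by (simp add: field_simps)
    then show ?thesis using smooth_seminorm_scale_le[OF f K, of n c] p_eq by simp
  qed
qed

section \<open>Continuity of differentiation and multiplication\<close>

abbreviation smooth_topology :: "nat \<Rightarrow> ((nat \<Rightarrow> 'z::euclidean_space) \<Rightarrow> real) topology" where
  "smooth_topology k \<equiv> seminorm_topology (smooth_space k) (smooth_seminorms k)"

text \<open>Differentiation costs one order: the seminorm of order \<open>n\<close> of
  \<open>partial a g\<close> is bounded by the seminorm of order \<open>n + 1\<close> of
  \<open>g\<close> over the same compact set.\<close>

lemma continuous_partial:
  fixes f :: "'b \<Rightarrow> (nat \<Rightarrow> 'a::euclidean_space) \<Rightarrow> real"
  assumes a: "a \<in> {1..k} \<times> Basis" and f: "continuous_map X (smooth_topology k) f"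
  shows "continuous_map X (smooth_topology k) (\<lambda>x. partial a (f x))"
proof (rule smooth.continuous_into)
  have fS: "f x \<in> smooth_space k" if "x \<in> topspace X" for x
    using continuous_map_image_subset_topspace[OF f] that smooth.topspace by blast
  show "\<And>x. x \<in> topspace X \<Longrightarrow> partial a (f x) \<in> smooth_space k"
    using fS smooth_space_partial[OF _ a] by blast
  fix p :: "((nat \<Rightarrow> 'a) \<Rightarrow> real) \<Rightarrow> real" and x0 assume p: "p \<in> smooth_seminorms k" and x0: "x0 \<in> topspace X"
  obtain n K where p_eq: "p = smooth_seminorm k n K" and K: "compactin (tuples k) K"
    using p unfolding smooth_seminorms_def by blast
  let ?q = "smooth_seminorm k (Suc n) K"
  have q: "?q \<in> smooth_seminorms k" unfolding smooth_seminorms_def using K by blast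
  have "p (partial a g) \<le> ?q g" if g: "g \<in> smooth_space k" for g unfolding p_eq
  proof (rule smooth_seminorm_le)
    fix \<alpha> Z assume "\<alpha> \<in> (multi_indices k :: (nat \<times> 'a) list set)" "length \<alpha> \<le> n" "Z \<in> K"
    then show "\<bar>partials \<alpha> (partial a g) Z\<bar> \<le> ?q g"
      using le_smooth_seminorm[OF g K, of "\<alpha> @ [a]" "Suc n" Z] a by (auto simp: multi_indices_def)
  qed (rule smooth_seminorm_nonneg[OF g K])
  then have "\<forall>x\<in>topspace X. p (partial a (f x) - partial a (f x0)) \<le> ?q (f x - f x0)"
    using fS x0 partial_diff[OF _ _ a] smooth_space_diff by metis
  then show "\<exists>D. continuous_map X euclideanreal D \<and> D x0 = 0 \<and>
      (\<forall>x\<in>topspace X. p (partial a (f x) - partial a (f x0)) \<le> D x)"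
    using smooth.continuous_seminorm_diff[OF q fS[OF x0] f] smooth.zero[OF q]
    by (intro exI[of _ "\<lambda>x. ?q (f x - f x0)"]) simp
qed

text \<open>Leibniz rule: each derivative doubles the number of products, which gives
  \<open>2 ^ length \<alpha>\<close>. The induction splits off the last entry of the list because
  that derivative acts first on \<open>f * g\<close>; one factor is then replaced by its derivative,
  so \<open>f\<close> and \<open>g\<close> are generalized.\<close>

lemma partials_mult_le:
  fixes f :: "(nat \<Rightarrow> 'a::euclidean_space) \<Rightarrow> real"
  assumes "f \<in> smooth_space k" "g \<in> smooth_space k" "\<alpha> \<in> multi_indices k"
    and "\<And>\<beta>. \<beta> \<in> multi_indices k \<Longrightarrow> length \<beta> \<le> length \<alpha> \<Longrightarrow> \<bar>partials \<beta> f Z\<bar> \<le> A"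
    and "\<And>\<beta>. \<beta> \<in> multi_indices k \<Longrightarrow> length \<beta> \<le> length \<alpha> \<Longrightarrow> \<bar>partials \<beta> g Z\<bar> \<le> B"
  shows "\<bar>partials \<alpha> (f * g) Z\<bar> \<le> 2 ^ length \<alpha> * A * B"
  using assms
proof (induction \<alpha> arbitrary: f g rule: rev_induct)
  case Nil
  have "\<bar>f Z\<bar> \<le> A" "\<bar>g Z\<bar> \<le> B" using Nil(4,5)[of "[]"] by (auto simp: multi_indices_def)
  then have "\<bar>f Z\<bar> * \<bar>g Z\<bar> \<le> A * B" by (intro mult_mono) auto
  then show ?case by (simp add: times_fun_apply abs_mult)
next
  case (snoc a \<alpha>)
  have a: "a \<in> {1..k} \<times> Basis" and \<alpha>: "\<alpha> \<in> multi_indices k"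
    using snoc.prems(3) by (auto simp: multi_indices_def)
  have f': "partial a f \<in> smooth_space k" and g': "partial a g \<in> smooth_space k"
    using smooth_space_partial a snoc.prems by blast+
  have "\<bar>partials \<alpha> (partial a f * g) Z\<bar> \<le> 2 ^ length \<alpha> * A * B"
  proof (rule snoc.IH[OF f' snoc.prems(2) \<alpha>])
    fix \<beta> assume "\<beta> \<in> (multi_indices k :: (nat \<times> 'a) list set)" "length \<beta> \<le> length \<alpha>"
    then show "\<bar>partials \<beta> (partial a f) Z\<bar> \<le> A" "\<bar>partials \<beta> g Z\<bar> \<le> B"
      using snoc.prems(4)[of "\<beta> @ [a]"] snoc.prems(5)[of \<beta>] a by (auto simp: multi_indices_def)
  qed
  moreover have "\<bar>partials \<alpha> (f * partial a g) Z\<bar> \<le> 2 ^ length \<alpha> * A * B"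
  proof (rule snoc.IH[OF snoc.prems(1) g' \<alpha>])
    fix \<beta> assume "\<beta> \<in> (multi_indices k :: (nat \<times> 'a) list set)" "length \<beta> \<le> length \<alpha>"
    then show "\<bar>partials \<beta> f Z\<bar> \<le> A" "\<bar>partials \<beta> (partial a g) Z\<bar> \<le> B"
      using snoc.prems(5)[of "\<beta> @ [a]"] snoc.prems(4)[of \<beta>] a by (auto simp: multi_indices_def)
  qed
  moreover have "partials (\<alpha> @ [a]) (f * g) = partials \<alpha> (partial a f * g) + partials \<alpha> (f * partial a g)"
    using partial_mult[OF snoc.prems(1,2) a]
      partials_add[OF smooth_space_mult[OF f' snoc.prems(2)] smooth_space_mult[OF snoc.prems(1) g'] \<alpha>]
    by simp
  ultimately show ?case by (simp add: plus_fun_apply)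
qed

lemma continuous_mult:
  fixes f :: "'b \<Rightarrow> (nat \<Rightarrow> 'a::euclidean_space) \<Rightarrow> real"
  assumes f: "continuous_map X (smooth_topology k) f" and g: "continuous_map X (smooth_topology k) g"
  shows "continuous_map X (smooth_topology k) (\<lambda>x. f x * g x)"
proof (rule smooth.continuous_into)
  have fS: "f x \<in> smooth_space k" if "x \<in> topspace X" for x
    using continuous_map_image_subset_topspace[OF f] that smooth.topspace by blast
  have gS: "g x \<in> smooth_space k" if "x \<in> topspace X" for x
    using continuous_map_image_subset_topspace[OF g] that smooth.topspace by blast
  show "\<And>x. x \<in> topspace X \<Longrightarrow> f x * g x \<in> smooth_space k"
    using fS gS smooth_space_mult by blast
  fix p :: "((nat \<Rightarrow> 'a) \<Rightarrow> real) \<Rightarrow> real" and x0 assume p: "p \<in> smooth_seminorms k" and x0: "x0 \<in> topspace X"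
  obtain n K where p_eq: "p = smooth_seminorm k n K" and K: "compactin (tuples k) K"
    using p unfolding smooth_seminorms_def by blast
  have pm: "p (a * b) \<le> 2 ^ n * p a * p b" if a: "a \<in> smooth_space k" and b: "b \<in> smooth_space k" for a b
    unfolding p_eq
  proof (rule smooth_seminorm_le)
    show "0 \<le> 2 ^ n * smooth_seminorm k n K a * smooth_seminorm k n K b"
      using smooth_seminorm_nonneg[OF _ K] a b by simp
    fix \<alpha> Z assume \<alpha>: "\<alpha> \<in> (multi_indices k :: (nat \<times> 'a) list set)" "length \<alpha> \<le> n" "Z \<in> K"
    have "\<bar>partials \<alpha> (a * b) Z\<bar> \<le> 2 ^ length \<alpha> * smooth_seminorm k n K a * smooth_seminorm k n K b"
      using \<alpha> by (intro partials_mult_le[OF a b \<alpha>(1)] le_smooth_seminorm[OF a K] le_smooth_seminorm[OF b K]) auto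
    also have "\<dots> \<le> 2 ^ n * smooth_seminorm k n K a * smooth_seminorm k n K b"
      using smooth_seminorm_nonneg[OF _ K] a b \<alpha>(2) by (intro mult_right_mono) auto
    finally show "\<bar>partials \<alpha> (a * b) Z\<bar> \<le> 2 ^ n * smooth_seminorm k n K a * smooth_seminorm k n K b" .
  qed
  \<comment> \<open>Splits \<open>f g - f0 g0 = (f - f0) g + f0 (g - g0)\<close>, with
    \<open>2 ^ n\<close> from the Leibniz bound. The form \<open>p (g x - 0)\<close> makes the
    seminorm of \<open>g x\<close> itself an instance of
    \<open>continuous_seminorm_diff\<close>.\<close>
  let ?D = "\<lambda>x. 2 ^ n * p (f x - f x0) * p (g x - 0) + 2 ^ n * p (f x0) * p (g x - g x0)"
  have "continuous_map X euclideanreal ?D"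
    using smooth.continuous_seminorm_diff[OF p fS[OF x0] f]
      smooth.continuous_seminorm_diff[OF p gS[OF x0] g]
      smooth.continuous_seminorm_diff[OF p smooth_space_0 g]
    by (intro continuous_map_add continuous_map_real_mult) auto
  moreover have "p (f x * g x - f x0 * g x0) \<le> ?D x" if x: "x \<in> topspace X" for x
  proof -
    have eq: "f x * g x - f x0 * g x0 = (f x - f x0) * g x + f x0 * (g x - g x0)"
      by (simp add: algebra_simps)
    have "p (f x * g x - f x0 * g x0) \<le> p ((f x - f x0) * g x) + p (f x0 * (g x - g x0))"
      unfolding eq using smooth.triangle[OF p smooth_space_mult[OF smooth_space_diff[OF fS[OF x] fS[OF x0]] gS[OF x]]
          smooth_space_mult[OF fS[OF x0] smooth_space_diff[OF gS[OF x] gS[OF x0]]]] .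
    also have "\<dots> \<le> ?D x"
      using pm[OF smooth_space_diff[OF fS[OF x] fS[OF x0]] gS[OF x]]
        pm[OF fS[OF x0] smooth_space_diff[OF gS[OF x] gS[OF x0]]] by simp
    finally show ?thesis .
  qed
  ultimately show "\<exists>D. continuous_map X euclideanreal D \<and> D x0 = 0 \<and>
      (\<forall>x\<in>topspace X. p (f x * g x - f x0 * g x0) \<le> D x)"
    using smooth.zero[OF p] by (intro exI[of _ ?D]) simp
qed

subsection \<open>Symmetry of second derivatives\<close>

text \<open>The mean value theorem twice: for \<open>\<phi> s h - \<phi> s 0\<close> as a function
  of \<open>s\<close>, which yields \<open>x\<close>, and then for \<open>\<phi>s x t\<close> as a
  function of \<open>t\<close>, which yields \<open>y\<close>.\<close>

lemma second_difference:
  fixes \<phi> \<phi>s \<phi>st :: "real \<Rightarrow> real \<Rightarrow> real"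
  assumes s: "\<And>s t. ((\<lambda>s. \<phi> s t) has_real_derivative \<phi>s s t) (at s)"
    and st: "\<And>s t. ((\<lambda>t. \<phi>s s t) has_real_derivative \<phi>st s t) (at t)"
    and h: "0 < h"
  shows "\<exists>x y. 0 < x \<and> x < h \<and> 0 < y \<and> y < h \<and> \<phi> h h - \<phi> h 0 - \<phi> 0 h + \<phi> 0 0 = h * h * \<phi>st x y"
proof -
  have "\<exists>x. 0 < x \<and> x < h \<and> (\<phi> h h - \<phi> h 0) - (\<phi> 0 h - \<phi> 0 0) = (h - 0) * (\<phi>s x h - \<phi>s x 0)"
    by (rule MVT2[OF h]) (rule DERIV_diff[OF s s])
  then obtain x where x: "0 < x" "x < h"
    and xe: "(\<phi> h h - \<phi> h 0) - (\<phi> 0 h - \<phi> 0 0) = h * (\<phi>s x h - \<phi>s x 0)" by auto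
  have "\<exists>y. 0 < y \<and> y < h \<and> \<phi>s x h - \<phi>s x 0 = (h - 0) * \<phi>st x y"
    by (rule MVT2[OF h]) (rule st)
  then obtain y where y: "0 < y" "y < h" and ye: "\<phi>s x h - \<phi>s x 0 = h * \<phi>st x y" by auto
  show ?thesis using x y xe ye by (intro exI[of _ x] exI[of _ y]) simp
qed

text \<open>Schwarz's theorem. The second difference over the square of side \<open>h\<close> does
  not change when the variables are exchanged, so it equals both \<open>h * h * \<phi>st x y\<close>
  and \<open>h * h * \<phi>ts x' y'\<close> at points of the square; for small \<open>h\<close>,
  continuity at the origin puts these values close to those at the origin.\<close>

lemma mixed_derivatives:
  fixes \<phi> \<phi>s \<phi>t \<phi>st \<phi>ts :: "real \<Rightarrow> real \<Rightarrow> real"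
  assumes s: "\<And>s t. ((\<lambda>s. \<phi> s t) has_real_derivative \<phi>s s t) (at s)"
    and t: "\<And>s t. ((\<lambda>t. \<phi> s t) has_real_derivative \<phi>t s t) (at t)"
    and st: "\<And>s t. ((\<lambda>t. \<phi>s s t) has_real_derivative \<phi>st s t) (at t)"
    and ts: "\<And>s t. ((\<lambda>s. \<phi>t s t) has_real_derivative \<phi>ts s t) (at s)"
    and cst: "isCont (\<lambda>(s, t). \<phi>st s t) (0, 0)" and cts: "isCont (\<lambda>(s, t). \<phi>ts s t) (0, 0)"
  shows "\<phi>st 0 0 = \<phi>ts 0 0"
proof (rule ccontr)
  assume ne: "\<phi>st 0 0 \<noteq> \<phi>ts 0 0"
  \<comment> \<open>Half the supposed gap: no number is closer than \<open>e\<close> to both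
    values.\<close>
  define e where "e = \<bar>\<phi>st 0 0 - \<phi>ts 0 0\<bar> / 2"
  have e: "e > 0" using ne by (simp add: e_def)
  obtain d1 where d1: "d1 > 0" "\<And>p. dist p (0, 0) < d1 \<Longrightarrow> dist (case p of (s, t) \<Rightarrow> \<phi>st s t) (\<phi>st 0 0) < e"
    using cst e unfolding continuous_at_eps_delta by (metis (mono_tags) case_prod_conv)
  obtain d2 where d2: "d2 > 0" "\<And>p. dist p (0, 0) < d2 \<Longrightarrow> dist (case p of (s, t) \<Rightarrow> \<phi>ts s t) (\<phi>ts 0 0) < e"
    using cts e unfolding continuous_at_eps_delta by (metis (mono_tags) case_prod_conv)
  \<comment> \<open>Points of the open square of side \<open>h\<close> satisfy
    \<open>\<bar>x\<bar> + \<bar>y\<bar> < 2 * h = min d1 d2\<close>.\<close>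
  define h where "h = min d1 d2 / 2"
  have h: "h > 0" using d1 d2 by (simp add: h_def)
  have small: "dist (x, y) (0, 0) < min d1 d2" if "0 < x" "x < h" "0 < y" "y < h" for x y :: real
  proof -
    have "dist (x, y) (0, 0) \<le> \<bar>x\<bar> + \<bar>y\<bar>"
      by (simp add: dist_Pair_Pair dist_real_def sqrt_sum_squares_le_sum_abs)
    then show ?thesis using that by (simp add: h_def)
  qed
  obtain x y where xy: "0 < x" "x < h" "0 < y" "y < h"
    "\<phi> h h - \<phi> h 0 - \<phi> 0 h + \<phi> 0 0 = h * h * \<phi>st x y"
    using second_difference[OF s st h] by blast
  obtain y' x' where xy': "0 < y'" "y' < h" "0 < x'" "x' < h"
    "\<phi> h h - \<phi> 0 h - \<phi> h 0 + \<phi> 0 0 = h * h * \<phi>ts x' y'"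
    using second_difference[where \<phi> = "\<lambda>a b. \<phi> b a" and \<phi>s = "\<lambda>a b. \<phi>t b a"
        and \<phi>st = "\<lambda>a b. \<phi>ts b a", OF t ts h] by blast
  have "h * h * \<phi>st x y = h * h * \<phi>ts x' y'" using xy(5) xy'(5) by linarith
  then have "\<phi>st x y = \<phi>ts x' y'" using h by simp
  moreover have "dist (\<phi>st x y) (\<phi>st 0 0) < e" "dist (\<phi>ts x' y') (\<phi>ts 0 0) < e"
    using d1(2)[of "(x, y)"] d2(2)[of "(x', y')"] small xy xy' by simp_all
  ultimately show False unfolding e_def dist_real_def by (smt (verit) field_sum_of_halves)
qed

text \<open>The shifts are added up instead of nested as function updates, so that
  \<open>i = j\<close>, where both move the same point, needs no separate treatment.\<close>

lemma continuous_map_two_shifts: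
  fixes Z :: "nat \<Rightarrow> 'z::euclidean_space"
  assumes Z: "Z \<in> topspace (tuples k)" and i: "i \<in> {1..k}" and j: "j \<in> {1..k}"
  shows "continuous_map euclidean (tuples k)
    (\<lambda>(s, t). \<lambda>l. Z l + (if l = i then s *\<^sub>R u else 0) + (if l = j then t *\<^sub>R v else 0))"
  (is "continuous_map _ _ ?S")
  unfolding continuous_map_componentwise
proof
  show "?S ` topspace euclidean \<subseteq> extensional {1..k}"
  proof (rule image_subsetI, unfold extensional_def, intro CollectI allI impI)
    fix p :: "real \<times> real" and l assume l: "l \<notin> {1..k}"
    then have "l \<noteq> i" "l \<noteq> j" "Z l = undefined" using i j Z unfolding topspace_tuples extensional_def by auto
    then show "?S p l = undefined" by (simp add: case_prod_beta)
  qed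
  show "\<forall>l\<in>{1..k}. continuous_map euclidean euclidean (\<lambda>p. ?S p l)"
  proof
    fix l
    have eq: "?S p l = Z l + (if l = i then fst p *\<^sub>R u else 0) + (if l = j then snd p *\<^sub>R v else 0)" for p
      by (simp add: case_prod_beta)
    have "continuous_on UNIV (\<lambda>p. ?S p l)" unfolding eq
      by (cases "l = i"; cases "l = j") (auto intro!: continuous_intros)
    then show "continuous_map euclidean euclidean (\<lambda>p. ?S p l)" by simp
  qed
qed

lemma partial_commute:
  fixes f :: "(nat \<Rightarrow> 'z::euclidean_space) \<Rightarrow> real"
  assumes f: "f \<in> smooth_space k" and a: "a \<in> {1..k} \<times> Basis" and b: "b \<in> {1..k} \<times> Basis"
  shows "partial a (partial b f) = partial b (partial a f)"
proof
  fix Z :: "nat \<Rightarrow> 'z"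
  obtain i u where i: "a = (i, u)" "i \<in> {1..k}" "u \<in> Basis" using a by blast
  obtain j v where j: "b = (j, v)" "j \<in> {1..k}" "v \<in> Basis" using b by blast
  note fa = smooth_space_partial[OF f a] and fb = smooth_space_partial[OF f b]
  show "partial a (partial b f) Z = partial b (partial a f) Z"
  proof (cases "Z \<in> topspace (tuples k)")
    case False
    then show ?thesis
      using smooth_space_off[OF smooth_space_partial[OF fb a]] smooth_space_off[OF smooth_space_partial[OF fa b]]
      by simp
  next
    case True
    define S where "S = (\<lambda>s t l. Z l + (if l = i then s *\<^sub>R u else 0) + (if l = j then t *\<^sub>R v else 0))"
    have Ss: "(S 0 t)(i := S 0 t i + s *\<^sub>R u) = S s t" for s t by (auto simp: S_def algebra_simps)
    have St: "(S s 0)(j := S s 0 j + t *\<^sub>R v) = S s t" for s t by (auto simp: S_def algebra_simps)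
    have S0: "S 0 0 = Z" by (auto simp: S_def)
    have ds: "((\<lambda>s. g (S s t)) has_real_derivative partial a g (S s t)) (at s)"
      if "g \<in> smooth_space k" for g s t
      using has_derivative_partial[OF that i(2,3), of "S 0 t" s] unfolding Ss i(1) .
    have dt: "((\<lambda>t. g (S s t)) has_real_derivative partial b g (S s t)) (at t)"
      if "g \<in> smooth_space k" for g s t
      using has_derivative_partial[OF that j(2,3), of "S s 0" t] unfolding St j(1) .
    have cont: "isCont (\<lambda>(s, t). g (S s t)) (0, 0)" if "g \<in> smooth_space k" for g
    proof -
      have "continuous_map euclidean euclideanreal (g \<circ> (\<lambda>(s, t). S s t))"
        unfolding S_def
        by (rule continuous_map_compose[OF continuous_map_two_shifts[OF True i(2) j(2)] smooth_space_continuous[OF that]])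
      then have "continuous_on UNIV (g \<circ> (\<lambda>(s, t). S s t))" by simp
      moreover have "g \<circ> (\<lambda>(s, t). S s t) = (\<lambda>(s, t). g (S s t))" by auto
      ultimately show ?thesis by (metis continuous_on_eq_continuous_at iso_tuple_UNIV_I open_UNIV)
    qed
    have "partial b (partial a f) (S 0 0) = partial a (partial b f) (S 0 0)"
      by (rule mixed_derivatives[where \<phi> = "\<lambda>s t. f (S s t)"])
        (rule ds[OF f] dt[OF f] dt[OF fa] ds[OF fb] cont[OF smooth_space_partial[OF fa b]]
          cont[OF smooth_space_partial[OF fb a]])+
    then show ?thesis unfolding S0 by simp
  qed
qed

subsection \<open>Substitution of coordinates\<close>

text \<open>Coordinate \<open>i\<close> of the new tuple is coordinate \<open>p i\<close> of the old one, or the point \<open>0\<close> when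
  \<open>p i\<close> is not an index of the old tuple.\<close>

definition pull :: "nat \<Rightarrow> nat \<Rightarrow> (nat \<Rightarrow> nat) \<Rightarrow> (nat \<Rightarrow> 'z::euclidean_space) \<Rightarrow> nat \<Rightarrow> 'z" where
  "pull m n p Z = (\<lambda>i\<in>{1..m}. if p i \<in> {1..n} then Z (p i) else 0)"

definition substitute :: "nat \<Rightarrow> nat \<Rightarrow> (nat \<Rightarrow> nat) \<Rightarrow> ((nat \<Rightarrow> 'z::euclidean_space) \<Rightarrow> real) \<Rightarrow> (nat \<Rightarrow> 'z) \<Rightarrow> real" where
  "substitute m n p f Z = (if Z \<in> topspace (tuples n) then f (pull m n p Z) else 0)"

text \<open>Injectivity is asked only of slots filled by a true coordinate; any number of slots may
  hold the point 0. Each coordinate of the old tuple then occupies at most one slot, so the chain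
  rule for \<open>substitute\<close> has a single term.\<close>

definition inj_index :: "nat \<Rightarrow> nat \<Rightarrow> (nat \<Rightarrow> nat) \<Rightarrow> bool" where
  "inj_index m n p \<longleftrightarrow> inj_on p {i \<in> {1..m}. p i \<in> {1..n}}"

lemma pull_in_tuples: "pull m n p Z \<in> topspace (tuples m)"
  unfolding topspace_tuples pull_def by (rule restrict_extensional)

lemma continuous_map_pull: "continuous_map (tuples n) (tuples m) (pull m n p)"
  unfolding continuous_map_componentwise
proof
  show "pull m n p ` topspace (tuples n) \<subseteq> extensional {1..m}"
    using pull_in_tuples unfolding topspace_tuples by blast
  show "\<forall>i\<in>{1..m}. continuous_map (tuples n) euclidean (\<lambda>Z. pull m n p Z i)"
    by (auto simp: pull_def intro!: continuous_map_product_projection)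
qed

lemma pull_update:
  assumes "inj_index m n p" "a \<in> {1..m}" "p a \<in> {1..n}"
  shows "pull m n p (Z(p a := x)) = (pull m n p Z)(a := x)"
  using assms unfolding inj_index_def inj_on_def by (auto simp: pull_def fun_eq_iff fun_upd_apply)

lemma pull_update_outside:
  assumes "i \<notin> p ` {1..m}"
  shows "pull m n p (Z(i := x)) = pull m n p Z"
  using assms by (auto simp: pull_def fun_eq_iff fun_upd_apply)

lemma pull_apply: "i \<in> {1..m} \<Longrightarrow> p i \<in> {1..n} \<Longrightarrow> pull m n p Z i = Z (p i)"
  unfolding pull_def by simp

lemma substitute_derivative:
  fixes u :: "'z::euclidean_space"
  assumes p: "inj_index m n p" and f: "f \<in> smooth_space m"
    and a: "a \<in> {1..m}" "p a \<in> {1..n}" "u \<in> Basis"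
  shows "((\<lambda>t. substitute m n p f (Z(p a := Z (p a) + t *\<^sub>R u))) has_real_derivative
    substitute m n p (partial (a, u) f) Z) (at 0)"
proof (cases "Z \<in> topspace (tuples n)")
  case True
  have "substitute m n p f (Z(p a := Z (p a) + t *\<^sub>R u)) = f ((pull m n p Z)(a := pull m n p Z a + t *\<^sub>R u))" for t
    unfolding substitute_def pull_update[OF p a(1,2)] pull_apply[of a m p n, OF a(1,2)]
    using update_in_tuples[OF a(2), of Z] True by simp
  moreover have "substitute m n p (partial (a, u) f) Z = partial (a, u) f (pull m n p Z)"
    using True by (simp add: substitute_def)
  ultimately show ?thesis using has_derivative_partial_0[OF f a(1,3)] by presburger
next
  case False
  then have "substitute m n p f (Z(p a := Z (p a) + t *\<^sub>R u)) = 0" for t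
    unfolding substitute_def using update_in_tuples[OF a(2), of Z] by simp
  moreover have "substitute m n p (partial (a, u) f) Z = 0"
    using False by (simp add: substitute_def)
  ultimately show ?thesis by simp
qed

lemma substitute_derivative_outside:
  assumes i: "i \<notin> p ` {1..m}" "i \<in> {1..n}"
  shows "((\<lambda>t. substitute m n p f (Z(i := Z i + t *\<^sub>R u))) has_real_derivative 0) (at 0)"
proof -
  have "substitute m n p f (Z(i := Z i + t *\<^sub>R u)) = substitute m n p f Z" for t
    unfolding substitute_def pull_update_outside[OF i(1)] using update_in_tuples[OF i(2), of Z] by simp
  then show ?thesis by simp
qed

lemma partial_substitute:
  assumes "inj_index m n p" and "f \<in> smooth_space m" and "a \<in> {1..m}" "p a \<in> {1..n}" "u \<in> Basis"
  shows "partial (p a, u) (substitute m n p f) = substitute m n p (partial (a, u) f)"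
  using partial_eqI[OF substitute_derivative[OF assms]] by blast

lemma partial_substitute_outside:
  assumes "i \<notin> p ` {1..m}" "i \<in> {1..n}"
  shows "partial (i, u) (substitute m n p f) = 0"
  using partial_eqI[OF substitute_derivative_outside[OF assms]] by (auto simp: zero_fun_def)

text \<open>The family for \<open>smooth_space_coinduct\<close> consists of all substituted smooth
  functions: a derivative in a coordinate hit by \<open>p\<close> is again one of them, and in any
  other coordinate it is 0.\<close>

lemma substitute_smooth:
  fixes f :: "(nat \<Rightarrow> 'z::euclidean_space) \<Rightarrow> real"
  assumes p: "inj_index m n p" and f: "f \<in> smooth_space m"
  shows "substitute m n p f \<in> smooth_space n"
proof (rule smooth_space_coinduct[of _ "insert 0 (substitute m n p ` smooth_space m)"])
  fix g :: "(nat \<Rightarrow> 'z) \<Rightarrow> real"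
  assume g: "g \<in> insert 0 (substitute m n p ` smooth_space m)"
  show "continuous_map (tuples n) euclideanreal g"
  proof (cases "g = 0")
    case False
    then obtain h where h: "g = substitute m n p h" "h \<in> smooth_space m" using g by blast
    have "continuous_map (tuples n) euclideanreal (h \<circ> pull m n p)"
      by (rule continuous_map_compose[OF continuous_map_pull smooth_space_continuous[OF h(2)]])
    then show ?thesis by (rule continuous_map_eq) (simp add: h substitute_def)
  qed (simp add: zero_fun_def)
  show "g Z = 0" if "Z \<notin> topspace (tuples n)" for Z
    using g that by (auto simp: substitute_def zero_fun_apply)
  fix i and u :: 'z assume i: "i \<in> {1..n}" "u \<in> Basis"
  show "(\<lambda>t. g (Z(i := Z i + t *\<^sub>R u))) differentiable at 0" for Z
    using g
  proof (elim insertE imageE)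
    fix h assume h: "g = substitute m n p h" "h \<in> smooth_space m"
    show ?thesis
    proof (cases "i \<in> p ` {1..m}")
      case True
      then show ?thesis using substitute_derivative[OF p h(2) _ _ i(2)] i(1) h(1) real_differentiable_def by blast
    next
      case False
      then show ?thesis using substitute_derivative_outside[OF _ i(1)] h(1) real_differentiable_def by blast
    qed
  qed (simp add: zero_fun_apply)
  show "partial (i, u) g \<in> insert 0 (substitute m n p ` smooth_space m)"
    using g
  proof (elim insertE imageE)
    fix h assume h: "g = substitute m n p h" "h \<in> smooth_space m"
    show ?thesis
    proof (cases "i \<in> p ` {1..m}")
      case True
      then obtain a where a: "i = p a" "a \<in> {1..m}" by blast
      then show ?thesis
        using partial_substitute[OF p h(2) a(2) _ i(2)] smooth_space_partial[OF h(2), of "(a, u)"] i h(1) by auto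
    next
      case False
      then show ?thesis using partial_substitute_outside[OF _ i(1)] h(1) by blast
    qed
  qed (simp add: partial_zero)
qed (use f in blast)

text \<open>Each derivative either passes to the one slot that its coordinate fills, or meets no
  slot and kills the function. The order is preserved, which is what the seminorm estimate for
  \<open>substitute\<close> needs.\<close>

lemma partials_substitute:
  assumes p: "inj_index m n p" and f: "f \<in> smooth_space m" and \<alpha>: "\<alpha> \<in> multi_indices n"
  shows "partials \<alpha> (substitute m n p f) = 0 \<or>
    (\<exists>\<beta>\<in>multi_indices m. length \<beta> = length \<alpha> \<and> partials \<alpha> (substitute m n p f) = substitute m n p (partials \<beta> f))"
  using \<alpha>
proof (induction \<alpha>)
  case Nil
  then show ?case by (auto intro!: bexI[of _ "[]"] simp: multi_indices_def)
next
  case (Cons c \<alpha>)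
  then obtain i u where i: "c = (i, u)" "i \<in> {1..n}" "u \<in> Basis" and \<alpha>: "\<alpha> \<in> multi_indices n"
    by (auto simp: multi_indices_def)
  show ?case
  proof (cases "partials \<alpha> (substitute m n p f) = 0")
    case True
    then show ?thesis by (simp add: partial_zero)
  next
    case False
    then obtain \<beta> where \<beta>: "\<beta> \<in> multi_indices m" "length \<beta> = length \<alpha>"
      "partials \<alpha> (substitute m n p f) = substitute m n p (partials \<beta> f)" using Cons.IH[OF \<alpha>] by blast
    show ?thesis
    proof (cases "i \<in> p ` {1..m}")
      case True
      then obtain a where a: "i = p a" "a \<in> {1..m}" by blast
      have "partial c (substitute m n p (partials \<beta> f)) = substitute m n p (partial (a, u) (partials \<beta> f))"
        using partial_substitute[OF p smooth_space_partials[OF f \<beta>(1)] a(2) _ i(3)] i a by simp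
      then show ?thesis using \<beta> a i
        by (intro disjI2 bexI[of _ "(a, u) # \<beta>"]) (auto simp: multi_indices_def)
    next
      case False
      then have "partial c (substitute m n p (partials \<beta> f)) = 0"
        unfolding i(1) using i(2) by (intro partial_substitute_outside)
      then show ?thesis using \<beta>(3) by simp
    qed
  qed
qed

lemma substitute_add: "substitute m n p (f + g) = substitute m n p f + substitute m n p g"
  and substitute_diff: "substitute m n p (f - g) = substitute m n p f - substitute m n p g"
  and substitute_mult: "substitute m n p (f * g) = substitute m n p f * substitute m n p g"
  and substitute_scale: "substitute m n p (c *\<^sub>R f) = c *\<^sub>R substitute m n p f"
  and substitute_zero: "substitute m n p 0 = 0"
  by (auto simp: fun_eq_iff substitute_def zero_fun_apply minus_apply plus_fun_apply times_fun_apply scaleR_fun_apply)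

lemma substitute_sum: "substitute m n p (sum f I) = (\<Sum>i\<in>I. substitute m n p (f i))"
  by (induction I rule: infinite_finite_induct) (simp_all add: substitute_zero substitute_add)

text \<open>The seminorm of order \<open>r\<close> over \<open>K\<close> after the substitution is
  bounded by the one of the same order over the image of \<open>K\<close> under
  \<open>pull m n p\<close>, which is compact because that map is continuous.\<close>

lemma continuous_substitute:
  fixes f :: "'b \<Rightarrow> (nat \<Rightarrow> 'z::euclidean_space) \<Rightarrow> real"
  assumes p: "inj_index m n p" and f: "continuous_map X (smooth_topology m) f"
  shows "continuous_map X (smooth_topology n) (\<lambda>x. substitute m n p (f x))"
proof (rule smooth.continuous_into)
  have fS: "f x \<in> smooth_space m" if "x \<in> topspace X" for x
    using continuous_map_image_subset_topspace[OF f] that smooth.topspace by blast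
  show "\<And>x. x \<in> topspace X \<Longrightarrow> substitute m n p (f x) \<in> smooth_space n"
    using fS substitute_smooth[OF p] by blast
  fix s :: "((nat \<Rightarrow> 'z) \<Rightarrow> real) \<Rightarrow> real" and x0
  assume s: "s \<in> smooth_seminorms n" and x0: "x0 \<in> topspace X"
  obtain r K where s_eq: "s = smooth_seminorm n r K" and K: "compactin (tuples n) K"
    using s unfolding smooth_seminorms_def by blast
  have K': "compactin (tuples m) (pull m n p ` K)"
    by (rule image_compactin[OF K continuous_map_pull])
  let ?q = "smooth_seminorm m r (pull m n p ` K)"
  have q: "?q \<in> smooth_seminorms m" unfolding smooth_seminorms_def using K' by blast
  have le: "s (substitute m n p g) \<le> ?q g" if g: "g \<in> smooth_space m" for g unfolding s_eq
  proof (rule smooth_seminorm_le)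
    fix \<alpha> Z assume \<alpha>: "\<alpha> \<in> (multi_indices n :: (nat \<times> 'z) list set)" "length \<alpha> \<le> r" "Z \<in> K"
    have Z: "Z \<in> topspace (tuples n)" using \<alpha>(3) K compactin_subset_topspace by blast
    show "\<bar>partials \<alpha> (substitute m n p g) Z\<bar> \<le> ?q g"
      using partials_substitute[OF p g \<alpha>(1)]
    proof (elim disjE bexE conjE)
      assume "partials \<alpha> (substitute m n p g) = 0"
      then show ?thesis using smooth_seminorm_nonneg[OF g K'] by (simp add: zero_fun_apply)
    next
      fix \<beta> assume \<beta>: "\<beta> \<in> (multi_indices m :: (nat \<times> 'z) list set)" "length \<beta> = length \<alpha>"
        "partials \<alpha> (substitute m n p g) = substitute m n p (partials \<beta> g)"
      then show ?thesis using le_smooth_seminorm[OF g K' \<beta>(1), of r "pull m n p Z"] \<alpha> Z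
        by (simp add: substitute_def)
    qed
  qed (rule smooth_seminorm_nonneg[OF g K'])
  then have "\<forall>x\<in>topspace X. s (substitute m n p (f x) - substitute m n p (f x0)) \<le> ?q (f x - f x0)"
    using le[OF smooth_space_diff[OF fS fS[OF x0]]] by (simp add: substitute_diff)
  then show "\<exists>D. continuous_map X euclideanreal D \<and> D x0 = 0 \<and>
      (\<forall>x\<in>topspace X. s (substitute m n p (f x) - substitute m n p (f x0)) \<le> D x)"
    using smooth.continuous_seminorm_diff[OF q fS[OF x0] f] smooth.zero[OF q]
    by (intro exI[of _ "\<lambda>x. ?q (f x - f x0)"]) simp
qed

text \<open>Index 0 lies in no \<open>{1..r}\<close> and so encodes a slot that was already frozen
  at the point 0; this keeps the index maps closed under composition.\<close>

lemma pull_pull: "pull m n p (pull n r q Z) = pull m r (\<lambda>i. if p i \<in> {1..n} then q (p i) else 0) Z"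
  by (auto simp: pull_def fun_eq_iff)

lemma substitute_substitute:
  "substitute n r q (substitute m n p f) = substitute m r (\<lambda>i. if p i \<in> {1..n} then q (p i) else 0) f"
  unfolding substitute_def pull_pull[symmetric] by (auto simp: fun_eq_iff pull_in_tuples)

lemma substitute_cong:
  fixes f :: "(nat \<Rightarrow> 'z::euclidean_space) \<Rightarrow> real"
  assumes "\<And>i. i \<in> {1..m} \<Longrightarrow> p i \<in> {1..n} \<or> q i \<in> {1..n} \<Longrightarrow> p i = q i"
  shows "substitute m n p f = substitute m n q f"
proof -
  have "pull m n p Z i = pull m n q Z i" for Z :: "nat \<Rightarrow> 'z" and i
    using assms[of i] unfolding pull_def by (cases "i \<in> {1..m}") (auto simp del: atLeastAtMost_iff)
  then have "pull m n p Z = pull m n q Z" for Z :: "nat \<Rightarrow> 'z" by blast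
  then show ?thesis by (intro ext) (simp add: substitute_def)
qed

lemma substitute_identity:
  fixes f :: "(nat \<Rightarrow> 'z::euclidean_space) \<Rightarrow> real"
  assumes f: "f \<in> smooth_space k" and p: "\<And>i. i \<in> {1..k} \<Longrightarrow> p i = i"
  shows "substitute k k p f = f"
proof
  fix Z :: "nat \<Rightarrow> 'z"
  have "pull k k p Z = Z" if "Z \<in> topspace (tuples k)"
    using that p unfolding topspace_tuples by (auto simp: pull_def fun_eq_iff extensional_def)
  then show "substitute k k p f Z = f Z" using smooth_space_off[OF f] by (simp add: substitute_def)
qed

section \<open>The Poisson bracket\<close>

text \<open>The coordinate pairs are given by arbitrary maps \<open>x\<close> and \<open>v\<close>,
  since the Jacobi identity of such a bracket rests on the product rule and on commuting partial
  derivatives. The factor \<open>k\<close> of \<open>g_bracket\<close> is kept apart.\<close>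

definition poisson :: "'i set \<Rightarrow> ('i \<Rightarrow> nat \<times> 'z::euclidean_space) \<Rightarrow> ('i \<Rightarrow> nat \<times> 'z) \<Rightarrow>
    ((nat \<Rightarrow> 'z) \<Rightarrow> real) \<Rightarrow> ((nat \<Rightarrow> 'z) \<Rightarrow> real) \<Rightarrow> (nat \<Rightarrow> 'z) \<Rightarrow> real" where
  "poisson I x v f g = (\<Sum>a\<in>I. partial (x a) f * partial (v a) g - partial (v a) f * partial (x a) g)"

lemma poisson_antisym: "poisson I x v f g = - poisson I x v g f"
  unfolding poisson_def sum_negf[symmetric] by (simp add: mult.commute)

text \<open>One summand of the double bracket \<open>{f, {g, h}}\<close>. The arguments stand for
  partial derivatives: \<open>x\<close> and \<open>y\<close> for position and velocity in the outer
  coordinate pair, \<open>X\<close> and \<open>Y\<close> for those in the inner one, so that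
  \<open>gyX\<close> is \<open>g\<close> differentiated in the inner position and the outer
  velocity.\<close>

definition second_order_term :: "'r::comm_ring \<Rightarrow> 'r \<Rightarrow> 'r \<Rightarrow> 'r \<Rightarrow> 'r \<Rightarrow> 'r \<Rightarrow> 'r \<Rightarrow> 'r \<Rightarrow> 'r \<Rightarrow> 'r \<Rightarrow> 'r \<Rightarrow> 'r \<Rightarrow> 'r \<Rightarrow> 'r \<Rightarrow> 'r" where
  "second_order_term fx fy gX gY gxX gxY gyX gyY hX hY hxX hxY hyX hyY =
    fx * (gyX * hY + gX * hyY - gyY * hX - gY * hyX) - fy * (gxX * hY + gX * hxY - gxY * hX - gY * hxX)"

text \<open>The six double brackets of the Jacobi identity, restricted to a pair of canonical coordinate
  pairs, cancel after exchanging the two coordinate pairs.\<close>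

lemma second_order_cancel:
  "second_order_term fx fy gX gY gxX gxY gyX gyY hX hY hxX hxY hyX hyY
    + second_order_term gx gy hX hY hxX hxY hyX hyY fX fY fxX fxY fyX fyY
    + second_order_term hx hy fX fY fxX fxY fyX fyY gX gY gxX gxY gyX gyY
    + (second_order_term fX fY gx gy gxX gyX gxY gyY hx hy hxX hyX hxY hyY
    + second_order_term gX gY hx hy hxX hyX hxY hyY fx fy fxX fyX fxY fyY
    + second_order_term hX hY fx fy fxX fyX fxY fyY gx gy gxX gyX gxY gyY) = 0"
  unfolding second_order_term_def by (simp add: algebra_simps)

locale canonical_coordinates =
  fixes k :: nat and I :: "'i set" and x v :: "'i \<Rightarrow> nat \<times> 'z::euclidean_space"
  assumes x: "\<And>a. a \<in> I \<Longrightarrow> x a \<in> {1..k} \<times> Basis" and v: "\<And>a. a \<in> I \<Longrightarrow> v a \<in> {1..k} \<times> Basis"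
begin

lemma poisson_smooth:
  assumes "f \<in> smooth_space k" "g \<in> smooth_space k"
  shows "poisson I x v f g \<in> smooth_space k"
  unfolding poisson_def using assms x v
  by (intro smooth_space_sum smooth_space_diff smooth_space_mult smooth_space_partial)

lemma poisson_add_left:
  assumes "f \<in> smooth_space k" "g \<in> smooth_space k"
  shows "poisson I x v (f + g) h = poisson I x v f h + poisson I x v g h"
  unfolding poisson_def sum.distrib[symmetric]
  by (rule sum.cong) (simp_all add: partial_add[OF assms] x v algebra_simps)

lemma poisson_scale_left:
  assumes "f \<in> smooth_space k"
  shows "poisson I x v (c *\<^sub>R f) h = c *\<^sub>R poisson I x v f h"
proof -
  have "(c *\<^sub>R p) * q = c *\<^sub>R (p * q)" for p q :: "(nat \<Rightarrow> 'z) \<Rightarrow> real"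
    by (simp add: fun_eq_iff scaleR_fun_apply times_fun_apply)
  then show ?thesis unfolding poisson_def scaleR_sum_right
    by (intro sum.cong) (simp_all add: partial_scale[OF assms] x v scaleR_diff_right)
qed

lemma partial_poisson:
  assumes f: "f \<in> smooth_space k" and g: "g \<in> smooth_space k" and c: "c \<in> {1..k} \<times> Basis"
  shows "partial c (poisson I x v f g) =
    (\<Sum>a\<in>I. partial c (partial (x a) f) * partial (v a) g + partial (x a) f * partial c (partial (v a) g)
      - partial c (partial (v a) f) * partial (x a) g - partial (v a) f * partial c (partial (x a) g))"
proof -
  have "partial c (poisson I x v f g) =
      (\<Sum>a\<in>I. partial c (partial (x a) f * partial (v a) g - partial (v a) f * partial (x a) g))"
    unfolding poisson_def using x v
    by (intro partial_sum[OF _ c] smooth_space_diff smooth_space_mult smooth_space_partial f g)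
  also have "\<dots> = (\<Sum>a\<in>I. partial c (partial (x a) f) * partial (v a) g + partial (x a) f * partial c (partial (v a) g)
      - partial c (partial (v a) f) * partial (x a) g - partial (v a) f * partial c (partial (x a) g))"
  proof (rule sum.cong[OF refl])
    fix a assume a: "a \<in> I"
    note s = smooth_space_partial[OF f x[OF a]] smooth_space_partial[OF g x[OF a]]
      smooth_space_partial[OF f v[OF a]] smooth_space_partial[OF g v[OF a]]
    show "partial c (partial (x a) f * partial (v a) g - partial (v a) f * partial (x a) g) =
      partial c (partial (x a) f) * partial (v a) g + partial (x a) f * partial c (partial (v a) g)
      - partial c (partial (v a) f) * partial (x a) g - partial (v a) f * partial c (partial (x a) g)"
      unfolding partial_diff[OF smooth_space_mult[OF s(1,4)] smooth_space_mult[OF s(3,2)] c]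
        partial_mult[OF s(1,4) c] partial_mult[OF s(3,2) c] by (simp add: algebra_simps)
  qed
  finally show ?thesis .
qed

definition jacobi_term :: "((nat \<Rightarrow> 'z) \<Rightarrow> real) \<Rightarrow> ((nat \<Rightarrow> 'z) \<Rightarrow> real) \<Rightarrow> ((nat \<Rightarrow> 'z) \<Rightarrow> real) \<Rightarrow> 'i \<Rightarrow> 'i \<Rightarrow> (nat \<Rightarrow> 'z) \<Rightarrow> real" where
  "jacobi_term f g h a c = second_order_term (partial (x a) f) (partial (v a) f)
    (partial (x c) g) (partial (v c) g) (partial (x a) (partial (x c) g)) (partial (x a) (partial (v c) g))
    (partial (v a) (partial (x c) g)) (partial (v a) (partial (v c) g))
    (partial (x c) h) (partial (v c) h) (partial (x a) (partial (x c) h)) (partial (x a) (partial (v c) h))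
    (partial (v a) (partial (x c) h)) (partial (v a) (partial (v c) h))"

lemma poisson_poisson:
  assumes g: "g \<in> smooth_space k" and h: "h \<in> smooth_space k"
  shows "poisson I x v f (poisson I x v g h) = (\<Sum>a\<in>I. \<Sum>c\<in>I. jacobi_term f g h a c)"
proof -
  have "poisson I x v f (poisson I x v g h) =
      (\<Sum>a\<in>I. partial (x a) f * partial (v a) (poisson I x v g h) - partial (v a) f * partial (x a) (poisson I x v g h))"
    by (simp add: poisson_def[of I x v f])
  also have "\<dots> = (\<Sum>a\<in>I. \<Sum>c\<in>I. jacobi_term f g h a c)"
    by (rule sum.cong[OF refl])
      (simp only: partial_poisson[OF g h x] partial_poisson[OF g h v] jacobi_term_def second_order_term_def
        sum_distrib_left sum_subtractf[symmetric])
  finally show ?thesis .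
qed

text \<open>The cyclic sum \<open>U a c\<close> need not vanish for a single ordered pair; only
  \<open>U a c + U c a\<close> does. So the double sum is counted twice, once with the roles of
  \<open>a\<close> and \<open>c\<close> exchanged.\<close>

lemma poisson_jacobi:
  assumes f: "f \<in> smooth_space k" and g: "g \<in> smooth_space k" and h: "h \<in> smooth_space k"
  shows "poisson I x v f (poisson I x v g h) + poisson I x v g (poisson I x v h f)
    + poisson I x v h (poisson I x v f g) = 0"
proof -
  define U where "U = (\<lambda>a c. jacobi_term f g h a c + jacobi_term g h f a c + jacobi_term h f g a c)"
  let ?S = "\<Sum>a\<in>I. \<Sum>c\<in>I. U a c"
  have U: "U a c + U c a = 0" if a: "a \<in> I" and c: "c \<in> I" for a c
  proof -
    \<comment> \<open>Puts the derivatives of pair \<open>a\<close> outermost, so that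
      \<open>U c a\<close> involves the same second derivatives as \<open>U a c\<close>.\<close>
    have comm: "partial (x c) (partial (x a) q) = partial (x a) (partial (x c) q)"
      "partial (v c) (partial (v a) q) = partial (v a) (partial (v c) q)"
      "partial (x c) (partial (v a) q) = partial (v a) (partial (x c) q)"
      "partial (v c) (partial (x a) q) = partial (x a) (partial (v c) q)"
      if "q \<in> smooth_space k" for q
      using partial_commute[OF that] x v a c by blast+
    show ?thesis unfolding U_def jacobi_term_def comm[OF f] comm[OF g] comm[OF h]
      by (rule second_order_cancel)
  qed
  have "?S + ?S = ?S + (\<Sum>a\<in>I. \<Sum>c\<in>I. U c a)" by (simp add: sum.swap[of "\<lambda>a c. U c a"])
  also have "\<dots> = (\<Sum>a\<in>I. \<Sum>c\<in>I. U a c + U c a)" by (simp add: sum.distrib)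
  also have "\<dots> = 0" by (simp add: U)
  finally have "2 *\<^sub>R ?S = 0" by (simp only: scaleR_2)
  then have "?S = 0" by (metis scaleR_eq_0_iff zero_neq_numeral)
  then show ?thesis unfolding poisson_poisson[OF g h] poisson_poisson[OF h f] poisson_poisson[OF f g]
    by (simp add: U_def sum.distrib)
qed

end

section \<open>The bracket on phase space\<close>

definition x_coord :: "nat \<times> (real ^ 'd) \<Rightarrow> nat \<times> 'd::finite phase" where
  "x_coord = (\<lambda>(i, b). (i, (b, 0)))"

definition v_coord :: "nat \<times> (real ^ 'd) \<Rightarrow> nat \<times> 'd::finite phase" where
  "v_coord = (\<lambda>(i, b). (i, (0, b)))"

lemma x_coord_in: "a \<in> {1..k} \<times> Basis \<Longrightarrow> x_coord a \<in> {1..k} \<times> Basis"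
  and v_coord_in: "a \<in> {1..k} \<times> Basis \<Longrightarrow> v_coord a \<in> {1..k} \<times> Basis"
  by (auto simp: x_coord_def v_coord_def Basis_prod_def)

interpretation phase: canonical_coordinates k "{1..k} \<times> Basis" x_coord v_coord
  by unfold_locales (fact x_coord_in v_coord_in)+

lemma sum_fun_apply: "(\<Sum>i\<in>I. f i) Z = (\<Sum>i\<in>I. f i Z)"
  by (induction I rule: infinite_finite_induct) (simp_all add: plus_fun_apply zero_fun_apply)

lemma g_bracket_eq:
  "g_bracket k f g = real k *\<^sub>R poisson ({1..k} \<times> Basis) x_coord v_coord f g"
proof
  fix Z
  show "g_bracket k f g Z = (real k *\<^sub>R poisson ({1..k} \<times> Basis) x_coord v_coord f g) Z"
    unfolding g_bracket_def poisson_def scaleR_fun_apply sum_fun_apply sum.cartesian_product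
      x_coord_def v_coord_def minus_apply times_fun_apply
    by (simp add: case_prod_beta)
qed

lemma g_bracket_smooth:
  "f \<in> smooth_space k \<Longrightarrow> g \<in> smooth_space k \<Longrightarrow> g_bracket k f g \<in> smooth_space k"
  unfolding g_bracket_eq by (intro smooth_space_scale phase.poisson_smooth)

lemma g_bracket_antisym: "g_bracket k f g = - g_bracket k g f"
  unfolding g_bracket_eq scaleR_minus_right[symmetric] by (rule arg_cong[OF poisson_antisym])

lemma g_bracket_add_left:
  assumes "f \<in> smooth_space k" "g \<in> smooth_space k"
  shows "g_bracket k (f + g) h = g_bracket k f h + g_bracket k g h"
  unfolding g_bracket_eq
  by (simp only: phase.poisson_add_left[OF assms] scaleR_add_right)

lemma g_bracket_scale_left:
  assumes "f \<in> smooth_space k"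
  shows "g_bracket k (c *\<^sub>R f) h = c *\<^sub>R g_bracket k f h"
  unfolding g_bracket_eq
  by (simp add: phase.poisson_scale_left[OF assms] mult.commute)

lemma g_bracket_add_right:
  assumes "f \<in> smooth_space k" "g \<in> smooth_space k"
  shows "g_bracket k h (f + g) = g_bracket k h f + g_bracket k h g"
proof -
  have "g_bracket k h (f + g) = - (g_bracket k f h + g_bracket k g h)"
    unfolding g_bracket_add_left[OF assms, symmetric] by (rule g_bracket_antisym)
  also have "\<dots> = - g_bracket k f h + - g_bracket k g h" by simp
  finally show ?thesis unfolding g_bracket_antisym[of k h f] g_bracket_antisym[of k h g] .
qed

lemma g_bracket_scale_right:
  assumes "f \<in> smooth_space k"
  shows "g_bracket k h (c *\<^sub>R f) = c *\<^sub>R g_bracket k h f"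
proof -
  have "g_bracket k h (c *\<^sub>R f) = - (c *\<^sub>R g_bracket k f h)"
    unfolding g_bracket_scale_left[OF assms, symmetric] by (rule g_bracket_antisym)
  then show ?thesis unfolding g_bracket_antisym[of k h f] by (simp only: scaleR_minus_right)
qed

lemma g_bracket_zero_left: "g_bracket k 0 h = 0"
  using g_bracket_scale_left[OF smooth_space_0, of k 0 h] by simp

lemma g_bracket_zero_right: "g_bracket k h 0 = 0"
  using g_bracket_scale_right[OF smooth_space_0, of k h 0] by simp

lemma g_bracket_sum_left:
  assumes "\<And>i. i \<in> I \<Longrightarrow> f i \<in> smooth_space k"
  shows "g_bracket k (\<Sum>i\<in>I. f i) h = (\<Sum>i\<in>I. g_bracket k (f i) h)"
  using assms
proof (induction I rule: infinite_finite_induct)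
  case (insert i I)
  then show ?case
    using g_bracket_add_left[of "f i" k "sum f I" h] smooth_space_sum[of I f k] by simp
qed (simp_all add: g_bracket_zero_left)

lemma g_bracket_sum_right:
  assumes "\<And>i. i \<in> I \<Longrightarrow> f i \<in> smooth_space k"
  shows "g_bracket k h (\<Sum>i\<in>I. f i) = (\<Sum>i\<in>I. g_bracket k h (f i))"
  using assms
proof (induction I rule: infinite_finite_induct)
  case (insert i I)
  then show ?case
    using g_bracket_add_right[of "f i" k "sum f I" h] smooth_space_sum[of I f k] by simp
qed (simp_all add: g_bracket_zero_right)

lemma g_bracket_jacobi:
  fixes f g h :: "'d::finite observable"
  assumes f: "f \<in> smooth_space k" and g: "g \<in> smooth_space k" and h: "h \<in> smooth_space k"
  shows "g_bracket k f (g_bracket k g h) + g_bracket k g (g_bracket k h f)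
    + g_bracket k h (g_bracket k f g) = 0"
proof -
  let ?p = "poisson ({1..k} \<times> Basis) x_coord v_coord"
  have "g_bracket k a (g_bracket k b c) = (real k * real k) *\<^sub>R ?p a (?p b c)"
    if "b \<in> smooth_space k" "c \<in> smooth_space k" for a b c :: "'d observable"
    using g_bracket_scale_right[OF phase.poisson_smooth[OF that], of a "real k"]
    by (simp add: g_bracket_eq)
  then show ?thesis
    using phase.poisson_jacobi[OF f g h] f g h
    by (simp add: scaleR_add_right[symmetric])
qed

lemma continuous_g_bracket:
  fixes f g :: "'b \<Rightarrow> 'd::finite observable"
  assumes f: "continuous_map X (smooth_topology k) f" and g: "continuous_map X (smooth_topology k) g"
  shows "continuous_map X (smooth_topology k) (\<lambda>x. g_bracket k (f x) (g x))"
  unfolding g_bracket_eq poisson_def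
proof (rule smooth.continuous_scaled[OF _ smooth.continuous_sum])
  fix a :: "nat \<times> (real ^ 'd)" assume a: "a \<in> {1..k} \<times> Basis"
  note c = continuous_partial[OF x_coord_in[OF a]] continuous_partial[OF v_coord_in[OF a]]
  show "continuous_map X (smooth_topology k) (\<lambda>x. partial (x_coord a) (f x) * partial (v_coord a) (g x)
      - partial (v_coord a) (f x) * partial (x_coord a) (g x))"
    by (intro smooth.continuous_diff continuous_mult c f g)
qed simp

subsection \<open>Permutation invariance\<close>

lemma pull_permutation:
  assumes \<sigma>: "\<sigma> permutes {1..k}" and Z: "Z \<in> topspace (tuples k)"
  shows "pull k k \<sigma> Z = Z \<circ> \<sigma>"
proof
  fix i show "pull k k \<sigma> Z i = (Z \<circ> \<sigma>) i"
    using permutes_in_image[OF \<sigma>, of i] permutes_not_in[OF \<sigma>, of i] Z unfolding topspace_tuples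
    by (cases "i \<in> {1..k}") (auto simp: pull_def extensional_def)
qed

text \<open>Invariance is turned into a fixed point condition for the operators
  \<open>substitute k k \<sigma>\<close>, so that their linearity, product and composition rules
  apply to it.\<close>

lemma g_space_iff:
  fixes f :: "'d::finite observable"
  shows "f \<in> g_space k \<longleftrightarrow> f \<in> smooth_space k \<and> (\<forall>\<sigma>. \<sigma> permutes {1..k} \<longrightarrow> substitute k k \<sigma> f = f)"
proof -
  have "(\<forall>Z. Z \<in> topspace (tuples k) \<longrightarrow> f (Z \<circ> \<sigma>) = f Z) \<longleftrightarrow> substitute k k \<sigma> f = f"
    if "f \<in> smooth_space k" "\<sigma> permutes {1..k}" for \<sigma>
  proof -
    have "substitute k k \<sigma> f Z = (if Z \<in> topspace (tuples k) then f (Z \<circ> \<sigma>) else 0)" for Z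
      using pull_permutation[OF that(2), of Z] by (simp add: substitute_def)
    then show ?thesis using smooth_space_off[OF that(1)] unfolding fun_eq_iff[of "substitute k k \<sigma> f"]
      by simp
  qed
  then show ?thesis unfolding g_space_def smooth_space_def by blast
qed

lemma inj_index_permutation: "\<sigma> permutes {1..k} \<Longrightarrow> inj_index k k \<sigma>"
  unfolding inj_index_def using permutes_inj inj_on_subset by blast

lemma subspace_g_space: "subspace (g_space k)"
  by (rule subspaceI) (simp_all add: g_space_iff smooth_space_0 smooth_space_add smooth_space_scale
      substitute_zero substitute_add substitute_scale)

lemma g_space_smooth: "g_space k \<subseteq> smooth_space k"
  by (auto simp: g_space_iff)

lemma g_topology_eq: "g_topology k = seminorm_topology (g_space k) (smooth_seminorms k)"
  unfolding g_topology_def smooth_seminorms_def ..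

text \<open>Substitution along \<open>\<sigma>\<close> turns the derivatives at point
  \<open>i\<close> into those at point \<open>\<sigma> i\<close>, and the bracket sums over all
  points, so the permutation only reorders the sum.\<close>

lemma substitute_g_bracket:
  assumes \<sigma>: "\<sigma> permutes {1..k}" and f: "f \<in> smooth_space k" and g: "g \<in> smooth_space k"
  shows "g_bracket k (substitute k k \<sigma> f) (substitute k k \<sigma> g) = substitute k k \<sigma> (g_bracket k f g)"
proof -
  let ?s = "substitute k k \<sigma>"
  have p: "partial (x_coord (\<sigma> i, b)) (?s h) = ?s (partial (x_coord (i, b)) h)"
    "partial (v_coord (\<sigma> i, b)) (?s h) = ?s (partial (v_coord (i, b)) h)"
    if "i \<in> {1..k}" "b \<in> Basis" "h \<in> smooth_space k" for i b h
    using partial_substitute[OF inj_index_permutation[OF \<sigma>] that(3,1)] permutes_in_image[OF \<sigma>, of i] that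
    unfolding x_coord_def v_coord_def by (simp_all add: Basis_prod_def)
  define F where "F = (\<lambda>i. \<Sum>b\<in>Basis. partial (x_coord (i, b)) (?s f) * partial (v_coord (i, b)) (?s g)
      - partial (v_coord (i, b)) (?s f) * partial (x_coord (i, b)) (?s g))"
  define E where "E = (\<lambda>i. \<Sum>b\<in>Basis. partial (x_coord (i, b)) f * partial (v_coord (i, b)) g
      - partial (v_coord (i, b)) f * partial (x_coord (i, b)) g)"
  have "(\<Sum>i\<in>{1..k}. F i) = (\<Sum>i\<in>{1..k}. F (\<sigma> i))"
    using sum.permute[OF \<sigma>, of F] by (simp add: comp_def)
  also have "\<dots> = (\<Sum>i\<in>{1..k}. ?s (E i))"
    by (intro sum.cong refl)
      (simp add: F_def E_def p f g substitute_sum substitute_diff substitute_mult del: atLeastAtMost_iff)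
  also have "\<dots> = ?s (\<Sum>i\<in>{1..k}. E i)" by (simp only: substitute_sum)
  finally have "(\<Sum>i\<in>{1..k}. F i) = ?s (\<Sum>i\<in>{1..k}. E i)" .
  moreover have "g_bracket k (?s f) (?s g) = real k *\<^sub>R (\<Sum>i\<in>{1..k}. F i)"
    "g_bracket k f g = real k *\<^sub>R (\<Sum>i\<in>{1..k}. E i)"
    unfolding g_bracket_eq poisson_def F_def E_def sum.cartesian_product by (simp_all add: case_prod_beta)
  ultimately show ?thesis by (simp add: substitute_scale)
qed

lemma g_bracket_in_g_space: "f \<in> g_space k \<Longrightarrow> g \<in> g_space k \<Longrightarrow> g_bracket k f g \<in> g_space k"
  unfolding g_space_iff using g_bracket_smooth substitute_g_bracket by metis

section \<open>The embeddings into functions of \<open>N\<close> points\<close>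

lemma finite_P_set: "finite (P_set k N)"
  unfolding P_set_def by (rule finite_subset[OF _ finite_PiE[of "{1..k}" "\<lambda>_. {1..N}"]]) auto

lemma P_set_range: "j \<in> P_set k N \<Longrightarrow> i \<in> {1..k} \<Longrightarrow> j i \<in> {1..N}"
  unfolding P_set_def by blast

lemma P_set_inj: "j \<in> P_set k N \<Longrightarrow> inj_on j {1..k}"
  unfolding P_set_def by blast

lemma inj_index_P_set: "j \<in> P_set k N \<Longrightarrow> inj_index k N j"
  unfolding inj_index_def by (rule inj_on_subset[OF P_set_inj]) auto

lemma identity_in_P_set: "k \<le> N \<Longrightarrow> restrict id {1..k} \<in> P_set k N"
  unfolding P_set_def by (auto simp: inj_on_def)

lemma card_P_set_pos: "k \<le> N \<Longrightarrow> 0 < card (P_set k N)"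
  using identity_in_P_set finite_P_set card_gt_0_iff by blast

lemma eps_eq:
  fixes f :: "'d::finite observable"
  shows "eps k N f = (1 / real (card (P_set k N))) *\<^sub>R (\<Sum>j\<in>P_set k N. substitute k N j f)"
proof
  fix Z :: "nat \<Rightarrow> 'd phase"
  have "restrict (\<lambda>i. Z (j i)) {1..k} = pull k N j Z" if "j \<in> P_set k N" for j
    unfolding pull_def by (rule restrict_ext) (simp add: P_set_range[OF that] del: atLeastAtMost_iff)
  then show "eps k N f Z = ((1 / real (card (P_set k N))) *\<^sub>R (\<Sum>j\<in>P_set k N. substitute k N j f)) Z"
    by (simp add: eps_def scaleR_fun_apply sum_fun_apply substitute_def)
qed

lemma eps_add: "eps k N (f + g) = eps k N f + eps k N g"
  unfolding eps_eq by (simp add: substitute_add sum.distrib scaleR_add_right)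

lemma eps_scale: "eps k N (c *\<^sub>R f) = c *\<^sub>R eps k N f"
  unfolding eps_eq by (simp add: substitute_scale scaleR_sum_right[symmetric] mult.commute)

lemma eps_smooth: "f \<in> smooth_space k \<Longrightarrow> eps k N f \<in> smooth_space N"
  unfolding eps_eq by (intro smooth_space_scale smooth_space_sum substitute_smooth inj_index_P_set)

lemma continuous_eps:
  assumes "continuous_map X (smooth_topology k) f"
  shows "continuous_map X (smooth_topology N) (\<lambda>x. eps k N (f x))"
  unfolding eps_eq using assms
  by (intro smooth.continuous_scaled smooth.continuous_sum continuous_substitute inj_index_P_set) simp

lemma subspace_eps_image: "subspace (eps k N ` (g_space k :: 'd::finite observable set))"
proof (rule subspaceI)
  show "0 \<in> eps k N ` (g_space k :: 'd observable set)"
    using subspace_0[OF subspace_g_space[of k]] eps_scale[of k N 0 0] by (metis image_eqI scaleR_zero_left)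
next
  fix f g :: "'d observable"
  assume "f \<in> eps k N ` g_space k" "g \<in> eps k N ` g_space k"
  then obtain f' g' where "f = eps k N f'" "g = eps k N g'" "f' \<in> g_space k" "g' \<in> g_space k" by blast
  then show "f + g \<in> eps k N ` g_space k"
    by (intro image_eqI[of _ _ "f' + g'"]) (simp_all add: eps_add subspace_add[OF subspace_g_space])
next
  fix c and f :: "'d observable"
  assume "f \<in> eps k N ` g_space k"
  then obtain f' where "f = eps k N f'" "f' \<in> g_space k" by blast
  then show "c *\<^sub>R f \<in> eps k N ` g_space k"
    by (intro image_eqI[of _ _ "c *\<^sub>R f'"]) (simp_all add: eps_scale subspace_scale[OF subspace_g_space])
qed

lemma P_set_compose:
  assumes "\<sigma> permutes {1..N}" "j \<in> P_set k N"
  shows "restrict (\<sigma> \<circ> j) {1..k} \<in> P_set k N"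
proof -
  have "inj_on (\<sigma> \<circ> j) {1..k}"
    by (rule comp_inj_on[OF P_set_inj[OF assms(2)] inj_on_subset[OF permutes_inj[OF assms(1)]]]) simp
  moreover have "\<sigma> (j i) \<in> {1..N}" if "i \<in> {1..k}" for i
    using permutes_in_image[OF assms(1)] P_set_range[OF assms(2) that] by blast
  ultimately show ?thesis unfolding P_set_def by (auto simp: inj_on_def simp del: atLeastAtMost_iff)
qed

text \<open>Following a selection of points by \<open>\<sigma>\<close> permutes the injective
  selections, so the average does not change.\<close>

lemma eps_in_g_space:
  assumes f: "f \<in> smooth_space k"
  shows "eps k N f \<in> g_space N"
  unfolding g_space_iff
proof (intro conjI allI impI)
  fix \<sigma> assume \<sigma>: "\<sigma> permutes {1..N}"
  let ?c = "\<lambda>\<sigma> j. restrict (\<sigma> \<circ> j) {1..k}"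
  have "(\<Sum>j\<in>P_set k N. substitute N N \<sigma> (substitute k N j f)) = (\<Sum>j\<in>P_set k N. substitute k N (?c \<sigma> j) f)"
    unfolding substitute_substitute
    by (intro sum.cong refl substitute_cong) (simp add: P_set_range del: atLeastAtMost_iff)
  also have "\<dots> = (\<Sum>j\<in>P_set k N. substitute k N j f)"
  proof (rule sum.reindex_bij_witness[of _ "?c (inv \<sigma>)" "?c \<sigma>"])
    have ext: "j i = undefined" if "j \<in> P_set k N" "i \<notin> {1..k}" for j i
      using that unfolding P_set_def by (auto simp: PiE_def extensional_def)
    show "?c (inv \<sigma>) (?c \<sigma> j) = j" "?c \<sigma> (?c (inv \<sigma>) j) = j" if "j \<in> P_set k N" for j
      using ext[OF that] permutes_inverses[OF \<sigma>] by (auto simp: fun_eq_iff simp del: atLeastAtMost_iff)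
    show "?c (inv \<sigma>) j \<in> P_set k N" "?c \<sigma> j \<in> P_set k N" if "j \<in> P_set k N" for j
      using P_set_compose[OF \<sigma> that] P_set_compose[OF permutes_inv[OF \<sigma>] that] by blast+
  qed simp
  finally show "substitute N N \<sigma> (eps k N f) = eps k N f"
    unfolding eps_eq by (simp add: substitute_scale substitute_sum)
qed (rule eps_smooth[OF f])

text \<open>The complements of \<open>A\<close> and of its image have equally many elements; any
  bijection between them completes \<open>p\<close>.\<close>

lemma extend_to_permutation:
  fixes p :: "'a \<Rightarrow> 'a"
  assumes S: "finite S" and A: "A \<subseteq> S" and inj: "inj_on p A" and p: "p ` A \<subseteq> S"
  shows "\<exists>\<sigma>. \<sigma> permutes S \<and> (\<forall>i\<in>A. \<sigma> i = p i)"
proof -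
  have "card (S - A) = card (S - p ` A)"
    using card_Diff_subset[OF finite_subset[OF A S] A] card_Diff_subset[OF finite_subset[OF p S] p]
      card_image[OF inj] by simp
  then obtain g where g: "bij_betw g (S - A) (S - p ` A)"
    using finite_same_card_bij[of "S - A" "S - p ` A"] S by auto
  define \<sigma> where "\<sigma> = (\<lambda>i. if i \<in> A then p i else if i \<in> S then g i else i)"
  have "bij_betw \<sigma> A (p ` A)" using inj by (simp add: bij_betw_def \<sigma>_def inj_on_def)
  moreover have "bij_betw \<sigma> (S - A) (S - p ` A)"
    using g by (rule bij_betw_cong[THEN iffD1, rotated]) (simp add: \<sigma>_def)
  ultimately have "bij_betw \<sigma> (A \<union> (S - A)) (p ` A \<union> (S - p ` A))"
    by (rule bij_betw_combine) blast
  then have "bij_betw \<sigma> S S" using A p by (simp add: Un_absorb1)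
  then have "\<sigma> permutes S" using A by (intro bij_imp_permutes) (auto simp: \<sigma>_def)
  then show ?thesis by (auto simp: \<sigma>_def)
qed

subsection \<open>A continuous left inverse\<close>

text \<open>An index map for \<open>substitute\<close>: the points in \<open>R\<close> stay free,
  all others are frozen at the point 0, which index 0 encodes.\<close>

definition keep :: "nat set \<Rightarrow> nat \<Rightarrow> nat" where
  "keep R i = (if i \<in> R then i else 0)"

lemma inj_index_keep: "inj_index m n (keep R)"
  unfolding inj_index_def by (auto simp: inj_on_def keep_def split: if_splits)

text \<open>By symmetry of \<open>f\<close> only the set of free points that occur matters, not
  their slots. The slots \<open>A\<close> filled by free points are carried by \<open>j\<close> into
  \<open>R \<subseteq> {1..k}\<close>, so \<open>j\<close> restricted to \<open>A\<close> extends to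
  a permutation of \<open>{1..k}\<close>, which \<open>f\<close> absorbs. Points of \<open>R\<close>
  missed by \<open>j\<close> are lost, and this makes the system for the left inverse
  triangular.\<close>

lemma substitute_keep_substitute:
  assumes f: "f \<in> g_space k" and R: "R \<subseteq> {1..k}" and j: "j \<in> P_set k N"
  shows "substitute N k (keep R) (substitute k N j f) = substitute k k (keep (R \<inter> j ` {1..k})) f"
proof -
  define A where "A = {i \<in> {1..k}. j i \<in> R}"
  have "\<exists>\<tau>. \<tau> permutes {1..k} \<and> (\<forall>i\<in>A. \<tau> i = j i)"
  proof (rule extend_to_permutation)
    show "inj_on j A" by (rule inj_on_subset[OF P_set_inj[OF j]]) (auto simp: A_def)
  qed (use R in \<open>auto simp: A_def\<close>)
  then obtain \<tau> where \<tau>: "\<tau> permutes {1..k}" and \<tau>j: "\<And>i. i \<in> A \<Longrightarrow> \<tau> i = j i" by blast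
  let ?Q = "R \<inter> j ` {1..k}"
  have "substitute k k (keep ?Q) f = substitute k k (keep ?Q) (substitute k k \<tau> f)"
    using f \<tau> by (simp add: g_space_iff)
  also have "\<dots> = substitute k k (\<lambda>i. if \<tau> i \<in> {1..k} then keep ?Q (\<tau> i) else 0) f"
    by (rule substitute_substitute)
  also have "\<dots> = substitute k k (\<lambda>i. if j i \<in> {1..N} then keep R (j i) else 0) f"
  proof (rule substitute_cong)
    fix i assume i: "i \<in> {1..k}"
    have \<tau>i: "\<tau> i \<in> {1..k}" using permutes_in_image[OF \<tau>] i by blast
    show "(if \<tau> i \<in> {1..k} then keep ?Q (\<tau> i) else 0) = (if j i \<in> {1..N} then keep R (j i) else 0)"
    proof (cases "i \<in> A")
      case True
      then show ?thesis using \<tau>j[OF True] \<tau>i i P_set_range[OF j i] by (auto simp: keep_def A_def)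
    next
      case False
      have "\<tau> i \<notin> ?Q"
      proof
        assume "\<tau> i \<in> ?Q"
        then obtain i' where i': "i' \<in> {1..k}" "\<tau> i = j i'" "j i' \<in> R" by auto
        then have "\<tau> i' = \<tau> i" using \<tau>j[of i'] by (simp add: A_def)
        then have "i' = i" using permutes_inj[OF \<tau>] by (simp add: inj_eq)
        then show False using False i' by (simp add: A_def)
      qed
      then show ?thesis using False i by (auto simp: keep_def A_def)
    qed
  qed
  also have "\<dots> = substitute N k (keep R) (substitute k N j f)"
    by (rule substitute_substitute[symmetric])
  finally show ?thesis ..
qed

text \<open>Evaluating \<open>eps k N f\<close> with all points outside \<open>R\<close> set to \<open>0\<close> yields a positive multiple of
  the same evaluation of \<open>f\<close>, plus evaluations of \<open>f\<close> for proper subsets of \<open>R\<close>; so the system of these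
  evaluations is triangular.\<close>

lemma recover_from_eps:
  fixes R :: "nat set"
  assumes kN: "k \<le> N" and R: "R \<subseteq> {1..k}"
  shows "\<exists>L. continuous_map (smooth_topology N) (smooth_topology k) L \<and>
    (\<forall>f\<in>g_space k. L (eps k N f) = substitute k k (keep R) (f :: 'd::finite observable))"
proof -
  have "finite R" using R finite_subset by blast
  then show ?thesis using R
  proof (induction R rule: finite_psubset_induct)
    case (psubset R)
    define full where "full = {j \<in> P_set k N. R \<subseteq> j ` {1..k}}"
    define part where "part = P_set k N - full"
    have fin: "finite full" "finite part" unfolding full_def part_def using finite_P_set[of k N] by auto
    \<comment> \<open>The inclusion of \<open>{1..k}\<close> into \<open>{1..N}\<close> covers
      \<open>R\<close>, so the diagonal coefficient \<open>card full\<close> is nonzero.\<close>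
    have "restrict id {1..k} \<in> full" unfolding full_def using identity_in_P_set[OF kN] psubset.prems by auto
    then have c: "card full \<noteq> 0" using fin by auto
    have "\<forall>j\<in>part. \<exists>L. continuous_map (smooth_topology N) (smooth_topology k) L \<and>
        (\<forall>f\<in>g_space k. L (eps k N f) = substitute k k (keep (R \<inter> j ` {1..k})) (f :: 'd observable))"
    proof
      fix j assume "j \<in> part"
      then have "R \<inter> j ` {1..k} \<subset> R" unfolding part_def full_def by blast
      then show "\<exists>L. continuous_map (smooth_topology N) (smooth_topology k) L \<and>
          (\<forall>f\<in>g_space k. L (eps k N f) = substitute k k (keep (R \<inter> j ` {1..k})) (f :: 'd observable))"
        using psubset.IH psubset.prems by blast
    qed
    then obtain M where M: "\<And>j. j \<in> part \<Longrightarrow> continuous_map (smooth_topology N) (smooth_topology k) (M j)"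
      "\<And>j f. j \<in> part \<Longrightarrow> f \<in> g_space k \<Longrightarrow>
        M j (eps k N f) = substitute k k (keep (R \<inter> j ` {1..k})) (f :: 'd observable)"
      unfolding bchoice_iff by blast
    \<comment> \<open>Isolates the terms with \<open>j\<close> in \<open>full\<close>, each of which
      is the wanted evaluation of \<open>f\<close>, and divides by their number.\<close>
    define L where "L = (\<lambda>h. (1 / real (card full)) *\<^sub>R
      (real (card (P_set k N)) *\<^sub>R substitute N k (keep R) h - (\<Sum>j\<in>part. M j h)))"
    have "continuous_map (smooth_topology N) (smooth_topology k) L"
      unfolding L_def
      by (intro smooth.continuous_scaled smooth.continuous_diff smooth.continuous_sum M
          continuous_substitute[OF inj_index_keep]) (simp_all add: continuous_map_id[unfolded id_def])
    moreover have "L (eps k N f) = substitute k k (keep R) f" if f: "f \<in> g_space k" for f :: "'d observable"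
    proof -
      have "real (card (P_set k N)) *\<^sub>R substitute N k (keep R) (eps k N f) =
          (\<Sum>j\<in>P_set k N. substitute N k (keep R) (substitute k N j f))"
        using card_P_set_pos[OF kN] by (simp add: eps_eq substitute_scale substitute_sum)
      also have "\<dots> = (\<Sum>j\<in>P_set k N. substitute k k (keep (R \<inter> j ` {1..k})) f)"
        by (intro sum.cong refl substitute_keep_substitute[OF f psubset.prems])
      also have "\<dots> = (\<Sum>j\<in>part. substitute k k (keep (R \<inter> j ` {1..k})) f)
          + (\<Sum>j\<in>full. substitute k k (keep (R \<inter> j ` {1..k})) f)"
        unfolding part_def by (rule sum.subset_diff) (auto simp: full_def finite_P_set)
      also have "(\<Sum>j\<in>full. substitute k k (keep (R \<inter> j ` {1..k})) f) = (\<Sum>j\<in>full. substitute k k (keep R) f)"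
        by (intro sum.cong refl) (simp add: full_def Int_absorb2)
      also have "\<dots> = real (card full) *\<^sub>R substitute k k (keep R) f" by (rule sum_constant_scaleR)
      finally show ?thesis using c by (simp add: L_def M(2)[OF _ f])
    qed
    ultimately show ?case by blast
  qed
qed

lemma eps_left_inverse:
  assumes "k \<le> N"
  obtains L where "continuous_map (smooth_topology N) (smooth_topology k) L"
    and "\<And>f :: 'd::finite observable. f \<in> g_space k \<Longrightarrow> L (eps k N f) = f"
proof -
  have "substitute k k (keep {1..k}) f = f" if "f \<in> g_space k" for f :: "'d observable"
    using that by (intro substitute_identity) (auto simp: g_space_iff keep_def)
  moreover obtain L where "continuous_map (smooth_topology N) (smooth_topology k) L"
    "\<And>f :: 'd observable. f \<in> g_space k \<Longrightarrow> L (eps k N f) = substitute k k (keep {1..k}) f"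
    using recover_from_eps[OF assms subset_refl] by blast
  ultimately show thesis by (intro that) auto
qed

lemma inj_on_eps: assumes "k \<le> N" shows "inj_on (eps k N) (g_space k :: 'd::finite observable set)"
proof -
  obtain L where "\<And>f :: 'd observable. f \<in> g_space k \<Longrightarrow> L (eps k N f) = f"
    using eps_left_inverse[OF assms] by blast
  then show ?thesis by (rule inj_on_inverseI[of _ L])
qed

text \<open>On the image of \<open>eps k N\<close> the inverse agrees with the left inverse
  \<open>L\<close>, which is continuous on all smooth functions. \<open>L\<close> maps only into
  \<open>smooth_space k\<close>; that the values are symmetric comes from \<open>im\<close>.\<close>

lemma continuous_inv_eps:
  fixes h :: "'b \<Rightarrow> 'd::finite observable"
  assumes kN: "k \<le> N" and h: "continuous_map X (smooth_topology N) h"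
    and im: "\<And>x. x \<in> topspace X \<Longrightarrow> h x \<in> eps k N ` g_space k"
  shows "continuous_map X (g_topology k) (\<lambda>x. inv_into (g_space k) (eps k N) (h x))"
proof -
  obtain L where L: "continuous_map (smooth_topology N) (smooth_topology k) L"
    "\<And>f :: 'd observable. f \<in> g_space k \<Longrightarrow> L (eps k N f) = f" using eps_left_inverse[OF kN] by blast
  have "L (h x) = inv_into (g_space k) (eps k N) (h x)" if x: "x \<in> topspace X" for x
    using L(2)[OF inv_into_into[OF im[OF x]]] unfolding f_inv_into_f[OF im[OF x]] .
  then have "continuous_map X (smooth_topology k) (\<lambda>x. inv_into (g_space k) (eps k N) (h x))"
    by (intro continuous_map_eq[OF continuous_map_compose[OF h L(1)]]) simp
  then show ?thesis unfolding g_topology_eq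
    using im by (intro smooth.continuous_into_subspace[OF subspace_g_space g_space_smooth]) (auto intro: inv_into_into)
qed

section \<open>Symmetrization and the image of the embeddings\<close>

text \<open>A projection of the smooth functions onto the symmetric ones. It serves to place the
  single terms of a bracket, which are not symmetric, in the image of an embedding.\<close>

definition symmetrize :: "nat \<Rightarrow> ((nat \<Rightarrow> 'z::euclidean_space) \<Rightarrow> real) \<Rightarrow> (nat \<Rightarrow> 'z) \<Rightarrow> real" where
  "symmetrize N h = (1 / fact N) *\<^sub>R (\<Sum>\<sigma> | \<sigma> permutes {1..N}. substitute N N \<sigma> h)"

lemma symmetrize_sum: "symmetrize N (\<Sum>i\<in>I. h i) = (\<Sum>i\<in>I. symmetrize N (h i))"
  unfolding symmetrize_def substitute_sum scaleR_sum_right by (rule sum.swap)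

lemma symmetrize_scale: "symmetrize N (c *\<^sub>R h) = c *\<^sub>R symmetrize N h"
  unfolding symmetrize_def by (simp add: substitute_scale scaleR_sum_right[symmetric] mult.commute)

lemma symmetrize_zero: "symmetrize N 0 = 0"
  unfolding symmetrize_def by (simp add: substitute_zero)

lemma symmetrize_g_space: "h \<in> g_space N \<Longrightarrow> symmetrize N h = h"
  unfolding symmetrize_def by (simp add: g_space_iff card_permutations sum_constant_scaleR del: sum_constant)

lemma substitute_permutations:
  assumes "\<rho> permutes {1..N}"
  shows "substitute N N \<sigma> (substitute N N \<rho> h) = substitute N N (\<sigma> \<circ> \<rho>) h"
  unfolding substitute_substitute
  using permutes_in_image[OF assms] by (intro substitute_cong) (simp del: atLeastAtMost_iff)

lemma symmetrize_permutation:
  assumes "\<rho> permutes {1..N}"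
  shows "symmetrize N (substitute N N \<rho> h) = symmetrize N h"
  unfolding symmetrize_def substitute_permutations[OF assms]
  using sum_permutations_compose_right[OF assms, of "\<lambda>\<sigma>. substitute N N \<sigma> h"] by simp

lemma symmetrize_in_g_space:
  assumes h: "h \<in> smooth_space N"
  shows "symmetrize N h \<in> g_space N"
  unfolding g_space_iff
proof (intro conjI allI impI)
  show "symmetrize N h \<in> smooth_space N"
    unfolding symmetrize_def
    by (intro smooth_space_scale smooth_space_sum substitute_smooth h inj_index_permutation) simp
  fix \<sigma> assume \<sigma>: "\<sigma> permutes {1..N}"
  have "(\<Sum>\<rho> | \<rho> permutes {1..N}. substitute N N \<sigma> (substitute N N \<rho> h)) =
      (\<Sum>\<rho> | \<rho> permutes {1..N}. substitute N N (\<sigma> \<circ> \<rho>) h)"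
    by (intro sum.cong refl substitute_permutations) simp
  also have "\<dots> = (\<Sum>\<rho> | \<rho> permutes {1..N}. substitute N N \<rho> h)"
    by (rule sum.reindex_bij_witness[of _ "(\<circ>) (inv \<sigma>)" "(\<circ>) \<sigma>"])
      (auto simp: o_assoc permutes_inv_o[OF \<sigma>] intro: permutes_compose permutes_inv \<sigma>)
  finally show "substitute N N \<sigma> (symmetrize N h) = symmetrize N h"
    unfolding symmetrize_def substitute_scale substitute_sum by simp
qed

section \<open>Functions depending on some of the points\<close>

definition depends_on :: "nat \<Rightarrow> nat set \<Rightarrow> ((nat \<Rightarrow> 'z::euclidean_space) \<Rightarrow> real) \<Rightarrow> bool" where
  "depends_on N D h \<longleftrightarrow> (\<forall>Z\<in>topspace (tuples N). \<forall>Z'\<in>topspace (tuples N). (\<forall>i\<in>D. Z i = Z' i) \<longrightarrow> h Z = h Z')"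

lemma depends_on_substitute:
  assumes j: "j \<in> P_set l N"
  shows "depends_on N (j ` {1..l}) (substitute l N j f)"
proof -
  have "pull l N j Z = pull l N j Z'" if "\<forall>i\<in>j ` {1..l}. Z i = Z' i" for Z Z' :: "nat \<Rightarrow> 'a"
    unfolding pull_def by (rule restrict_ext) (use that in simp)
  then show ?thesis unfolding depends_on_def substitute_def by metis
qed

lemma depends_on_partial:
  fixes h :: "(nat \<Rightarrow> 'z::euclidean_space) \<Rightarrow> real"
  assumes h: "depends_on N D h" and i: "i \<in> {1..N}"
  shows "depends_on N D (partial (i, u) h)"
  unfolding depends_on_def
proof (intro ballI impI)
  fix Z Z' :: "nat \<Rightarrow> 'z"
  assume Z: "Z \<in> topspace (tuples N)" "Z' \<in> topspace (tuples N)" and eq: "\<forall>i\<in>D. Z i = Z' i"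
  have "h (Z(i := Z i + t *\<^sub>R u)) = h (Z'(i := Z' i + t *\<^sub>R u))" for t
  proof -
    have "\<forall>l\<in>D. (Z(i := Z i + t *\<^sub>R u)) l = (Z'(i := Z' i + t *\<^sub>R u)) l" using eq by simp
    then show ?thesis using h update_in_tuples[OF i] Z unfolding depends_on_def by metis
  qed
  then show "partial (i, u) h Z = partial (i, u) h Z'" by (simp add: partial_def)
qed

lemma partial_independent:
  fixes h :: "(nat \<Rightarrow> 'z::euclidean_space) \<Rightarrow> real"
  assumes h: "h \<in> smooth_space N" "depends_on N D h" and i: "i \<in> {1..N}" "i \<notin> D" and u: "u \<in> Basis"
  shows "partial (i, u) h = 0"
proof
  fix Z :: "nat \<Rightarrow> 'z"
  show "partial (i, u) h Z = 0 Z"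
  proof (cases "Z \<in> topspace (tuples N)")
    case True
    have "h (Z(i := Z i + t *\<^sub>R u)) = h Z" for t
    proof -
      have "\<forall>l\<in>D. (Z(i := Z i + t *\<^sub>R u)) l = Z l" using i by auto
      then show ?thesis using h(2) update_in_tuples[OF i(1), of Z] True unfolding depends_on_def by metis
    qed
    then show ?thesis by (simp add: partial_def zero_fun_apply)
  next
    case False
    then show ?thesis
      using smooth_space_off[OF smooth_space_partial[OF h(1), of "(i, u)"]] i u by (simp add: zero_fun_apply)
  qed
qed

lemma depends_on_mono: "depends_on N D h \<Longrightarrow> D \<subseteq> E \<Longrightarrow> depends_on N E h"
  unfolding depends_on_def by blast

lemma depends_on_g_bracket:
  fixes f g :: "'d::finite observable"
  assumes f: "depends_on N D f" and g: "depends_on N E g"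
  shows "depends_on N (D \<union> E) (g_bracket N f g)"
proof -
  have "depends_on N (D \<union> E) (partial (i, u) f)" "depends_on N (D \<union> E) (partial (i, u) g)"
    if "i \<in> {1..N}" for i u
    using depends_on_partial[OF depends_on_mono[OF f] that] depends_on_partial[OF depends_on_mono[OF g] that]
    by blast+
  then show ?thesis unfolding depends_on_def[of N "D \<union> E"] g_bracket_def
    by (intro ballI impI arg_cong2[of _ _ _ _ "(*)"] sum.cong refl arg_cong2[of _ _ _ _ "(-)"]) blast+
qed

text \<open>Every product in the bracket differentiates both factors in the same point
  \<open>i\<close>, and \<open>i\<close> misses one of the two sets.\<close>

lemma g_bracket_disjoint:
  fixes f g :: "'d::finite observable"
  assumes f: "f \<in> smooth_space N" "depends_on N D f" and g: "g \<in> smooth_space N" "depends_on N E g"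
    and disj: "D \<inter> E = {}"
  shows "g_bracket N f g = 0"
proof -
  have zero: "partial (i, u) f Z * partial (i, u') g Z = 0"
    if "i \<in> {1..N}" "u \<in> Basis" "u' \<in> Basis" for i u u' Z
  proof -
    have "i \<notin> D \<or> i \<notin> E" using disj by blast
    then show ?thesis
      using partial_independent[OF f that(1) _ that(2)] partial_independent[OF g that(1) _ that(3)]
      by (auto simp: zero_fun_apply)
  qed
  show ?thesis
  proof
    fix Z :: "nat \<Rightarrow> 'd phase"
    have "(\<Sum>i=1..N. \<Sum>b\<in>Basis. partial (i, (b, 0)) f Z * partial (i, (0, b)) g Z
        - partial (i, (0, b)) f Z * partial (i, (b, 0)) g Z) = 0"
    proof (intro sum.neutral ballI)
      fix i and b :: "real ^ 'd" assume i: "i \<in> {1..N}" and b: "b \<in> Basis"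
      then have b': "(b, 0) \<in> (Basis :: 'd phase set)" "(0, b) \<in> (Basis :: 'd phase set)"
        by (auto simp: Basis_prod_def)
      show "partial (i, (b, 0)) f Z * partial (i, (0, b)) g Z
          - partial (i, (0, b)) f Z * partial (i, (b, 0)) g Z = 0"
        unfolding zero[OF i b'] zero[OF i b'(2,1)] by simp
    qed
    then show "g_bracket N f g Z = 0 Z" by (simp add: g_bracket_def zero_fun_apply)
  qed
qed

text \<open>After a permutation, \<open>h\<close> depends on the first \<open>k\<close> points only; all the embeddings of that
  function of \<open>k\<close> points into functions of \<open>N\<close> points have the same symmetrization as \<open>h\<close>.\<close>

lemma symmetrize_in_eps_image:
  fixes h :: "'d::finite observable"
  assumes kN: "k \<le> N" and D: "D \<subseteq> {1..N}" "card D \<le> k"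
    and h: "h \<in> smooth_space N" "depends_on N D h"
  shows "symmetrize N h \<in> eps k N ` g_space k"
proof -
  have "finite D" using D finite_subset by blast
  then obtain \<pi> where \<pi>: "\<pi> ` D \<subseteq> {1..k}" "inj_on \<pi> D"
    using card_le_inj[of D "{1..k}"] D by auto
  \<comment> \<open>\<open>\<pi>\<close> assigns to each index in \<open>D\<close> one of the first
    \<open>k\<close> points; \<open>h\<close> does not see the other slots, which are filled with
    the point 0.\<close>
  define q where "q = (\<lambda>i. if i \<in> D then \<pi> i else 0)"
  have q: "inj_index N k q"
    using \<pi> unfolding inj_index_def inj_on_def q_def by auto
  define f where "f = substitute N k q h"
  have fS: "f \<in> smooth_space k" unfolding f_def by (rule substitute_smooth[OF q h(1)])
  have *: "symmetrize N (substitute k N j (substitute k k \<tau> f)) = symmetrize N h"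
    if j: "j \<in> P_set k N" and \<tau>: "\<tau> permutes {1..k}" for j \<tau>
  proof -
    define r where "r = (\<lambda>i. if (if q i \<in> {1..k} then \<tau> (q i) else 0) \<in> {1..k}
      then j (if q i \<in> {1..k} then \<tau> (q i) else 0) else 0)"
    have r: "r i = j (\<tau> (\<pi> i))" and r': "\<tau> (\<pi> i) \<in> {1..k}" if "i \<in> D" for i
    proof -
      have "\<pi> i \<in> {1..k}" using \<pi>(1) that by blast
      then show "\<tau> (\<pi> i) \<in> {1..k}" using permutes_in_image[OF \<tau>] by blast
      then show "r i = j (\<tau> (\<pi> i))" using that \<open>\<pi> i \<in> {1..k}\<close> unfolding r_def q_def by simp
    qed
    \<comment> \<open>\<open>r\<close> is injective on \<open>D\<close> and sends the rest to 0. Its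
      values outside \<open>D\<close> do not affect \<open>h\<close>, so it may be replaced by a
      permutation, which \<open>symmetrize\<close> absorbs.\<close>
    have "\<exists>\<rho>. \<rho> permutes {1..N} \<and> (\<forall>i\<in>D. \<rho> i = r i)"
    proof (rule extend_to_permutation[OF _ D(1)])
      show "inj_on r D"
      proof (rule inj_onI)
        fix a b assume ab: "a \<in> D" "b \<in> D" "r a = r b"
        then have "\<tau> (\<pi> a) = \<tau> (\<pi> b)" using inj_onD[OF P_set_inj[OF j]] r r' by simp
        then have "\<pi> a = \<pi> b" using permutes_inj[OF \<tau>] by (simp add: inj_eq)
        then show "a = b" using inj_onD[OF \<pi>(2)] ab by blast
      qed
      show "r ` D \<subseteq> {1..N}" using r P_set_range[OF j r'] by auto
    qed simp
    then obtain \<rho> where \<rho>: "\<rho> permutes {1..N}" "\<And>i. i \<in> D \<Longrightarrow> \<rho> i = r i" by blast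
    have "substitute k N j (substitute k k \<tau> f) = substitute N N r h"
      unfolding f_def substitute_substitute r_def ..
    also have "\<dots> = substitute N N \<rho> h"
    proof
      fix Z :: "nat \<Rightarrow> 'd phase"
      have "\<forall>i\<in>D. pull N N r Z i = pull N N \<rho> Z i" using D(1) \<rho>(2) by (auto simp: pull_def)
      then have "h (pull N N r Z) = h (pull N N \<rho> Z)"
        using h(2) pull_in_tuples unfolding depends_on_def by blast
      then show "substitute N N r h Z = substitute N N \<rho> h Z" by (simp add: substitute_def)
    qed
    finally show ?thesis using symmetrize_permutation[OF \<rho>(1)] by simp
  qed
  \<comment> \<open>\<open>f\<close> need not be symmetric, so the preimage is
    \<open>symmetrize k f\<close>; in the resulting double average over selections \<open>j\<close>
    and permutations \<open>\<tau>\<close> all terms are equal by the previous claim.\<close>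
  have "eps k N (symmetrize k f) = symmetrize N (eps k N (symmetrize k f))"
    using symmetrize_in_g_space[OF fS] g_space_smooth
    by (intro symmetrize_g_space[symmetric] eps_in_g_space) blast
  also have "\<dots> = (1 / real (card (P_set k N))) *\<^sub>R (\<Sum>j\<in>P_set k N. (1 / fact k) *\<^sub>R
      (\<Sum>\<tau> | \<tau> permutes {1..k}. symmetrize N (substitute k N j (substitute k k \<tau> f))))"
    unfolding eps_eq symmetrize_def[of k] substitute_scale substitute_sum symmetrize_scale symmetrize_sum ..
  also have "\<dots> = (1 / real (card (P_set k N))) *\<^sub>R (\<Sum>j\<in>P_set k N. (1 / fact k) *\<^sub>R
      (\<Sum>\<tau> | \<tau> permutes {1..k}. symmetrize N h))"
  proof -
    have "(\<Sum>\<tau> | \<tau> permutes {1..k}. symmetrize N (substitute k N j (substitute k k \<tau> f))) =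
        (\<Sum>\<tau> | \<tau> permutes {1..k}. symmetrize N h)" if "j \<in> P_set k N" for j
      by (rule sum.cong[OF refl]) (use *[OF that] in blast)
    then show ?thesis by (simp del: sum_constant cong: sum.cong)
  qed
  also have "\<dots> = symmetrize N h"
    using card_P_set_pos[OF kN] by (simp add: card_permutations sum_constant_scaleR del: sum_constant)
  finally show ?thesis using symmetrize_in_g_space[OF fS] by (intro image_eqI[OF sym])
qed

text \<open>In the bilinear expansion over selections \<open>a\<close> and \<open>b\<close> the
  terms are not symmetric, and only their symmetrizations are known to lie in the image. The whole
  bracket is symmetric, hence equals its symmetrization, which may be computed term by term.\<close>

lemma g_bracket_in_eps_image:
  fixes f g :: "'d::finite observable"
  assumes l: "l \<in> {1..N}" and m: "m \<in> {1..N}" and k: "min (l + m - 1) N = k"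
    and f: "f \<in> g_space l" and g: "g \<in> g_space m"
  shows "g_bracket N (eps l N f) (eps m N g) \<in> eps k N ` g_space k"
proof -
  have fS: "f \<in> smooth_space l" and gS: "g \<in> smooth_space m" using f g g_space_smooth by blast+
  define F where "F = (\<lambda>a. substitute l N a f)"
  define G where "G = (\<lambda>b. substitute m N b g)"
  have FS: "F a \<in> smooth_space N" if "a \<in> P_set l N" for a
    unfolding F_def by (rule substitute_smooth[OF inj_index_P_set[OF that] fS])
  have GS: "G b \<in> smooth_space N" if "b \<in> P_set m N" for b
    unfolding G_def by (rule substitute_smooth[OF inj_index_P_set[OF that] gS])
  have *: "symmetrize N (g_bracket N (F a) (G b)) \<in> eps k N ` g_space k"
    if a: "a \<in> P_set l N" and b: "b \<in> P_set m N" for a b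
  proof -
    let ?A = "a ` {1..l}" and ?B = "b ` {1..m}"
    have F: "F a \<in> smooth_space N" "depends_on N ?A (F a)"
      using FS[OF a] depends_on_substitute[OF a, of f] by (simp_all add: F_def)
    have G: "G b \<in> smooth_space N" "depends_on N ?B (G b)"
      using GS[OF b] depends_on_substitute[OF b, of g] by (simp_all add: G_def)
    have sub: "?A \<union> ?B \<subseteq> {1..N}" using P_set_range[OF a] P_set_range[OF b] by blast
    show ?thesis
    proof (cases "?A \<inter> ?B = {}")
      case True
      then show ?thesis
        using g_bracket_disjoint[OF F G] subspace_0[OF subspace_eps_image] by (simp add: symmetrize_zero)
    next
      case False
      \<comment> \<open>A common point is counted twice in \<open>l + m\<close>; this is the 1
        subtracted in the degree.\<close>
      then have "card (?A \<inter> ?B) \<ge> 1" by (simp add: Suc_le_eq card_gt_0_iff One_nat_def)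
      moreover have "card (?A \<union> ?B) + card (?A \<inter> ?B) = l + m"
        using card_Un_Int[of ?A ?B] card_image[OF P_set_inj[OF a]] card_image[OF P_set_inj[OF b]] by simp
      moreover have "card (?A \<union> ?B) \<le> N" using card_mono[OF _ sub] by simp
      ultimately have "card (?A \<union> ?B) \<le> k" using k by linarith
      moreover have "k \<le> N" using k by linarith
      ultimately show ?thesis
        using symmetrize_in_eps_image[OF _ sub _ g_bracket_smooth[OF F(1) G(1)] depends_on_g_bracket[OF F(2) G(2)]]
        by blast
    qed
  qed
  let ?c = "1 / real (card (P_set l N))" and ?d = "1 / real (card (P_set m N))"
  have "g_bracket N (eps l N f) (eps m N g) =
      ?c *\<^sub>R (\<Sum>a\<in>P_set l N. ?d *\<^sub>R (\<Sum>b\<in>P_set m N. g_bracket N (F a) (G b)))"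
  proof -
    have "g_bracket N (eps l N f) (eps m N g) = ?c *\<^sub>R (\<Sum>a\<in>P_set l N. g_bracket N (F a) (eps m N g))"
      unfolding eps_eq[of l] F_def[symmetric]
      using FS by (simp add: g_bracket_scale_left g_bracket_sum_left smooth_space_sum)
    also have "\<dots> = ?c *\<^sub>R (\<Sum>a\<in>P_set l N. ?d *\<^sub>R (\<Sum>b\<in>P_set m N. g_bracket N (F a) (G b)))"
      unfolding eps_eq[of m] G_def[symmetric]
      using GS by (simp add: g_bracket_scale_right g_bracket_sum_right smooth_space_sum)
    finally show ?thesis .
  qed
  moreover have "symmetrize N (g_bracket N (eps l N f) (eps m N g)) = g_bracket N (eps l N f) (eps m N g)"
    by (intro symmetrize_g_space g_bracket_in_g_space eps_in_g_space fS gS)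
  ultimately have "g_bracket N (eps l N f) (eps m N g) =
      symmetrize N (?c *\<^sub>R (\<Sum>a\<in>P_set l N. ?d *\<^sub>R (\<Sum>b\<in>P_set m N. g_bracket N (F a) (G b))))"
    by argo
  also have "\<dots> = ?c *\<^sub>R (\<Sum>a\<in>P_set l N. ?d *\<^sub>R (\<Sum>b\<in>P_set m N. symmetrize N (g_bracket N (F a) (G b))))"
    by (simp only: symmetrize_scale symmetrize_sum)
  also have "\<dots> \<in> eps k N ` g_space k"
    by (intro subspace_scale[OF subspace_eps_image] subspace_sum[OF subspace_eps_image] *)
  finally show ?thesis .
qed

section \<open>The Lie algebra of sequences\<close>

lemma G_space_component: "F \<in> G_space N \<Longrightarrow> k \<in> {1..N} \<Longrightarrow> F k \<in> g_space k"
  and G_space_outside: "F \<in> G_space N \<Longrightarrow> k \<notin> {1..N} \<Longrightarrow> F k = 0"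
  unfolding G_space_def by blast+

lemma subspace_G_space: "subspace (G_space N)"
  by (rule subspaceI)
    (auto simp: G_space_def plus_fun_apply zero_fun_apply scaleR_fun_apply subspace_0[OF subspace_g_space]
      subspace_add[OF subspace_g_space] subspace_scale[OF subspace_g_space])

lemma g_seminorm_family: "seminorm_family (g_space k) (smooth_seminorms k)"
  by (rule smooth.sub_family[OF subspace_g_space g_space_smooth])

lemma topspace_g_topology: "topspace (g_topology k) = g_space k"
  unfolding g_topology_eq by (rule seminorm_family.topspace[OF g_seminorm_family])

lemma topspace_G_topology: "topspace (G_topology N) = G_space N"
proof -
  have "restrict F {1..N} \<in> topspace (product_topology g_topology {1..N})" if "F \<in> G_space N"
    for F :: "nat \<Rightarrow> 'd::finite observable"
    using G_space_component[OF that]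
    by (simp add: topspace_product_topology topspace_g_topology del: atLeastAtMost_iff)
  then show ?thesis unfolding G_topology_def topspace_pullback_topology by blast
qed

lemma continuous_into_G_topology:
  assumes f: "\<And>x. x \<in> topspace X \<Longrightarrow> f x \<in> G_space N"
    and c: "\<And>k. k \<in> {1..N} \<Longrightarrow> continuous_map X (g_topology k) (\<lambda>x. f x k)"
  shows "continuous_map X (G_topology N) f"
  unfolding G_topology_def
proof (rule continuous_map_pullback')
  show "continuous_map X (product_topology g_topology {1..N}) ((\<lambda>F. restrict F {1..N}) \<circ> f)"
    unfolding continuous_map_componentwise using c by auto
qed (use f in auto)

lemma continuous_G_component:
  assumes k: "k \<in> {1..N}"
  shows "continuous_map (G_topology N) (g_topology k) (\<lambda>F. F k)"
proof -
  have "continuous_map (G_topology N) (g_topology k) ((\<lambda>F. F k) \<circ> (\<lambda>F. restrict F {1..N}))"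
    unfolding G_topology_def by (rule continuous_map_pullback[OF continuous_map_product_projection[OF k]])
  then show ?thesis using k by (simp add: comp_def)
qed

text \<open>The zero seminorm is included so that the family is nonempty for \<open>N = 0\<close>.\<close>

definition G_seminorms :: "nat \<Rightarrow> ((nat \<Rightarrow> 'd::finite observable) \<Rightarrow> real) set" where
  "G_seminorms N = insert (\<lambda>_. 0) {\<lambda>F. p (F k) | p k. k \<in> {1..N} \<and> p \<in> smooth_seminorms k}"

lemma G_seminorm_family: "seminorm_family (G_space N :: (nat \<Rightarrow> 'd::finite observable) set) (G_seminorms N)"
proof
  show "subspace (G_space N :: (nat \<Rightarrow> 'd observable) set)" by (rule subspace_G_space)
  show "G_seminorms N \<noteq> ({} :: ((nat \<Rightarrow> 'd observable) \<Rightarrow> real) set)" unfolding G_seminorms_def by blast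
next
  fix q :: "(nat \<Rightarrow> 'd observable) \<Rightarrow> real" and F G :: "nat \<Rightarrow> 'd observable"
  assume q: "q \<in> G_seminorms N" and F: "F \<in> G_space N" and G: "G \<in> G_space N"
  show "q (F + G) \<le> q F + q G"
  proof (cases "q = (\<lambda>_. 0)")
    case False
    then obtain p k where p: "q = (\<lambda>F. p (F k))" "k \<in> {1..N}" "p \<in> smooth_seminorms k"
      using q unfolding G_seminorms_def by blast
    show ?thesis unfolding p(1) plus_fun_apply[of F G]
      by (rule seminorm_family.triangle[OF g_seminorm_family p(3) G_space_component[OF F p(2)]
            G_space_component[OF G p(2)]])
  qed simp
next
  fix q :: "(nat \<Rightarrow> 'd observable) \<Rightarrow> real" and F :: "nat \<Rightarrow> 'd observable" and c
  assume q: "q \<in> G_seminorms N" and F: "F \<in> G_space N"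
  show "q (c *\<^sub>R F) = \<bar>c\<bar> * q F"
  proof (cases "q = (\<lambda>_. 0)")
    case False
    then obtain p k where p: "q = (\<lambda>F. p (F k))" "k \<in> {1..N}" "p \<in> smooth_seminorms k"
      using q unfolding G_seminorms_def by blast
    show ?thesis unfolding p(1) scaleR_fun_apply[of c F]
      by (rule seminorm_family.scale[OF g_seminorm_family p(3) G_space_component[OF F p(2)]])
  qed simp
qed

text \<open>The identity is continuous in both directions: components are continuous for the
  seminorms, and each nonzero seminorm of the family sees one component only. Local convexity then
  comes from the general result on seminorm topologies.\<close>

lemma G_topology_eq:
  "G_topology N = seminorm_topology (G_space N :: (nat \<Rightarrow> 'd::finite observable) set) (G_seminorms N)"
    (is "_ = ?T")
proof -
  interpret G: seminorm_family "G_space N :: (nat \<Rightarrow> 'd observable) set" "G_seminorms N"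
    by (rule G_seminorm_family)
  have to: "continuous_map ?T (G_topology N) (\<lambda>F. F)"
  proof (rule continuous_into_G_topology)
    fix k assume k: "k \<in> {1..N}"
    show "continuous_map ?T (g_topology k) (\<lambda>F. F k)"
      unfolding g_topology_eq
    proof (rule seminorm_family.continuous_into[OF g_seminorm_family])
      show "\<And>F. F \<in> topspace ?T \<Longrightarrow> F k \<in> g_space k"
        using G_space_component k G.topspace by blast
      fix p :: "'d observable \<Rightarrow> real" and F0 :: "nat \<Rightarrow> 'd observable"
      assume p: "p \<in> smooth_seminorms k" and F0: "F0 \<in> topspace ?T"
      let ?q = "\<lambda>F :: nat \<Rightarrow> 'd observable. p (F k)"
      have q: "?q \<in> G_seminorms N" unfolding G_seminorms_def using p k by blast
      have "continuous_map ?T euclideanreal (\<lambda>F. ?q (F - F0))"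
        using G.continuous_seminorm_diff[OF q, of F0 ?T "\<lambda>F. F"] F0 G.topspace by simp
      then show "\<exists>D. continuous_map ?T euclideanreal D \<and> D F0 = 0 \<and> (\<forall>F\<in>topspace ?T. p (F k - F0 k) \<le> D F)"
        using G.zero[OF q] by (intro exI[of _ "\<lambda>F. ?q (F - F0)"]) (simp add: minus_apply)
    qed
  qed (simp add: G.topspace)
  have "continuous_map (G_topology N) ?T (\<lambda>F. F)"
  proof (rule G.continuous_into)
    fix q :: "(nat \<Rightarrow> 'd observable) \<Rightarrow> real" and F0 :: "nat \<Rightarrow> 'd observable"
    assume q: "q \<in> G_seminorms N" and F0: "F0 \<in> topspace (G_topology N)"
    show "\<exists>D. continuous_map (G_topology N) euclideanreal D \<and> D F0 = 0 \<and>
        (\<forall>F\<in>topspace (G_topology N). q (F - F0) \<le> D F)"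
    proof (cases "q = (\<lambda>_. 0)")
      case False
      then obtain p k where p: "q = (\<lambda>F. p (F k))" "k \<in> {1..N}" "p \<in> smooth_seminorms k"
        using q unfolding G_seminorms_def by blast
      have F0k: "F0 k \<in> g_space k" using F0 p(2) G_space_component topspace_G_topology by blast
      have "continuous_map (G_topology N) euclideanreal (\<lambda>F. p (F k - F0 k))"
        by (rule seminorm_family.continuous_seminorm_diff[OF g_seminorm_family p(3) F0k])
          (use continuous_G_component[OF p(2)] in \<open>simp add: g_topology_eq\<close>)
      then show ?thesis using seminorm_family.zero[OF g_seminorm_family p(3)]
        by (intro exI[of _ "\<lambda>F. p (F k - F0 k)"]) (simp add: p(1) minus_apply)
    qed (intro exI[of _ "\<lambda>_. 0"], simp)
  qed (simp add: topspace_G_topology)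
  with to have "openin (G_topology N) U \<longleftrightarrow> openin ?T U" for U
    using openin_continuous_map_preimage[of "G_topology N" ?T "\<lambda>F. F" U]
      openin_continuous_map_preimage[of ?T "G_topology N" "\<lambda>F. F" U]
      openin_subset[of "G_topology N" U] openin_subset[of ?T U]
    by (auto simp: topspace_G_topology G.topspace Int_absorb1 Collect_conj_eq)
  then show ?thesis by (rule topology_eq[THEN iffD2, OF allI])
qed

section \<open>Algebraic identities of the bracket on sequences\<close>

definition bracket_sum :: "nat \<Rightarrow> (nat \<Rightarrow> 'd::finite observable) \<Rightarrow> (nat \<Rightarrow> 'd observable) \<Rightarrow> nat \<Rightarrow> 'd observable" where
  "bracket_sum N F G k = (\<Sum>(l, j) \<in> {(l, j). l \<in> {1..N} \<and> j \<in> {1..N} \<and> min (l + j - 1) N = k}.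
    g_bracket N (eps l N (F l)) (eps j N (G j)))"

lemma finite_index_pairs: "finite {(l, j). l \<in> {1..N} \<and> j \<in> {1..N} \<and> P l j}" for N :: nat
  by (rule finite_subset[of _ "{1..N} \<times> {1..N}"]) auto

lemma bracket_sum_in_image:
  assumes "F \<in> G_space N" "G \<in> G_space N"
  shows "bracket_sum N F G k \<in> eps k N ` g_space k"
  unfolding bracket_sum_def
proof (rule subspace_sum[OF subspace_eps_image])
  fix x assume "x \<in> {(l, j). l \<in> {1..N} \<and> j \<in> {1..N} \<and> min (l + j - 1) N = k}"
  then obtain l j where x: "x = (l, j)" and lj: "l \<in> {1..N}" "j \<in> {1..N}" "min (l + j - 1) N = k"
    by blast
  show "(case x of (l, j) \<Rightarrow> g_bracket N (eps l N (F l)) (eps j N (G j))) \<in> eps k N ` g_space k"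
    unfolding x prod.case
    by (rule g_bracket_in_eps_image[OF lj G_space_component[OF assms(1) lj(1)] G_space_component[OF assms(2) lj(2)]])
qed

lemma G_bracket_eq:
  "k \<in> {1..N} \<Longrightarrow> G_bracket N F G k = inv_into (g_space k) (eps k N) (bracket_sum N F G k)"
  unfolding G_bracket_def bracket_sum_def by simp

lemma eps_G_bracket:
  assumes "F \<in> G_space N" "G \<in> G_space N" "k \<in> {1..N}"
  shows "eps k N (G_bracket N F G k) = bracket_sum N F G k"
  unfolding G_bracket_eq[OF assms(3)] by (rule f_inv_into_f[OF bracket_sum_in_image[OF assms(1,2)]])

lemma G_bracket_closed:
  assumes "F \<in> G_space N" "G \<in> G_space N"
  shows "G_bracket N F G \<in> G_space N"
proof -
  have "G_bracket N F G k \<in> g_space k" if "k \<in> {1..N}" for k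
    unfolding G_bracket_eq[OF that] by (rule inv_into_into[OF bracket_sum_in_image[OF assms]])
  moreover have "G_bracket N F G k = 0" if "k \<notin> {1..N}" for k
    using that by (simp add: G_bracket_def del: atLeastAtMost_iff)
  ultimately show ?thesis unfolding G_space_def by blast
qed

text \<open>Injectivity of every \<open>eps k N\<close>. Identities between sequences reduce, one
  degree at a time, to identities between functions of \<open>N\<close> points, where
  \<open>G_bracket\<close> becomes the explicit \<open>bracket_sum\<close>.\<close>

lemma G_space_eqI:
  assumes F: "F \<in> G_space N" and G: "G \<in> G_space N"
    and eq: "\<And>k. k \<in> {1..N} \<Longrightarrow> eps k N (F k) = eps k N (G k)"
  shows "F = G"
proof
  fix k show "F k = G k"
  proof (cases "k \<in> {1..N}")
    case True
    then have "k \<le> N" by simp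
    then show ?thesis
      by (rule inj_onD[OF inj_on_eps eq[OF True] G_space_component[OF F True] G_space_component[OF G True]])
  qed (simp add: G_space_outside[OF F] G_space_outside[OF G])
qed

lemma eps_G_space_smooth: "F \<in> G_space N \<Longrightarrow> k \<in> {1..N} \<Longrightarrow> eps k N (F k) \<in> smooth_space N"
  using G_space_component g_space_smooth eps_smooth by blast

lemma bracket_sum_add_left:
  assumes "F \<in> G_space N" "G \<in> G_space N"
  shows "bracket_sum N (F + G) H k = bracket_sum N F H k + bracket_sum N G H k"
  unfolding bracket_sum_def sum.distrib[symmetric]
  by (rule sum.cong)
    (auto simp: plus_fun_apply eps_add g_bracket_add_left eps_G_space_smooth[OF assms(1)]
      eps_G_space_smooth[OF assms(2)])

lemma bracket_sum_scale_left:
  assumes "F \<in> G_space N"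
  shows "bracket_sum N (c *\<^sub>R F) H k = c *\<^sub>R bracket_sum N F H k"
  unfolding bracket_sum_def scaleR_sum_right
  by (rule sum.cong) (auto simp: scaleR_fun_apply eps_scale g_bracket_scale_left eps_G_space_smooth[OF assms])

lemma bracket_sum_antisym: "bracket_sum N F G k = - bracket_sum N G F k"
  unfolding bracket_sum_def sum_negf[symmetric]
  by (rule sum.reindex_bij_witness[of _ prod.swap prod.swap])
    (auto simp: add.commute intro: g_bracket_antisym[symmetric])

lemma eps_uminus: "eps k N (- f) = - eps k N f"
  using eps_scale[of k N "-1" f] by simp

lemma G_bracket_add_left:
  assumes F: "F \<in> G_space N" and G: "G \<in> G_space N" and H: "H \<in> G_space N"
  shows "G_bracket N (F + G) H = G_bracket N F H + G_bracket N G H"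
proof (rule G_space_eqI)
  note FG = subspace_add[OF subspace_G_space F G]
  show "G_bracket N (F + G) H \<in> G_space N" by (rule G_bracket_closed[OF FG H])
  show "G_bracket N F H + G_bracket N G H \<in> G_space N"
    by (intro subspace_add[OF subspace_G_space] G_bracket_closed F G H)
  fix k assume k: "k \<in> {1..N}"
  show "eps k N (G_bracket N (F + G) H k) = eps k N ((G_bracket N F H + G_bracket N G H) k)"
    by (simp add: plus_fun_apply eps_add eps_G_bracket[OF FG H k] eps_G_bracket[OF F H k]
        eps_G_bracket[OF G H k] bracket_sum_add_left[OF F G])
qed

lemma G_bracket_scale_left:
  assumes F: "F \<in> G_space N" and H: "H \<in> G_space N"
  shows "G_bracket N (c *\<^sub>R F) H = c *\<^sub>R G_bracket N F H"
proof (rule G_space_eqI)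
  note cF = subspace_scale[OF subspace_G_space F, of c]
  show "G_bracket N (c *\<^sub>R F) H \<in> G_space N" by (rule G_bracket_closed[OF cF H])
  show "c *\<^sub>R G_bracket N F H \<in> G_space N"
    by (intro subspace_scale[OF subspace_G_space] G_bracket_closed F H)
  fix k assume k: "k \<in> {1..N}"
  show "eps k N (G_bracket N (c *\<^sub>R F) H k) = eps k N ((c *\<^sub>R G_bracket N F H) k)"
    by (simp add: scaleR_fun_apply eps_scale eps_G_bracket[OF cF H k] eps_G_bracket[OF F H k]
        bracket_sum_scale_left[OF F])
qed

lemma G_bracket_antisym:
  assumes F: "F \<in> G_space N" and G: "G \<in> G_space N"
  shows "G_bracket N F G = - G_bracket N G F"
proof (rule G_space_eqI)
  show "G_bracket N F G \<in> G_space N" by (rule G_bracket_closed[OF F G])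
  show "- G_bracket N G F \<in> G_space N"
    by (intro subspace_neg[OF subspace_G_space] G_bracket_closed F G)
  fix k assume k: "k \<in> {1..N}"
  show "eps k N (G_bracket N F G k) = eps k N ((- G_bracket N G F) k)"
    unfolding uminus_apply[of "G_bracket N G F"] eps_uminus eps_G_bracket[OF F G k] eps_G_bracket[OF G F k]
    by (rule bracket_sum_antisym)
qed

text \<open>The degrees entering a double bracket; each of the two brackets subtracts 1. All indices
  are at least 1, so the subtraction on naturals is exact. The condition is symmetric, so the sums
  in the Jacobi identity can be rotated.\<close>

definition triples :: "nat \<Rightarrow> nat \<Rightarrow> (nat \<times> nat \<times> nat) set" where
  "triples N k = {(l, a, b). l \<in> {1..N} \<and> a \<in> {1..N} \<and> b \<in> {1..N} \<and> min (l + a + b - 2) N = k}"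

definition triple_bracket :: "nat \<Rightarrow> (nat \<Rightarrow> 'd::finite observable) \<Rightarrow> (nat \<Rightarrow> 'd observable) \<Rightarrow>
    (nat \<Rightarrow> 'd observable) \<Rightarrow> nat \<Rightarrow> nat \<Rightarrow> nat \<Rightarrow> 'd observable" where
  "triple_bracket N F G H l a b =
    g_bracket N (eps l N (F l)) (g_bracket N (eps a N (G a)) (eps b N (H b)))"

text \<open>The truncation is compatible with nesting: \<open>min (l + min (a + b - 1) N - 1) N\<close> equals
  \<open>min (l + a + b - 2) N\<close>.\<close>

lemma bracket_sum_G_bracket:
  assumes F: "F \<in> G_space N" and G: "G \<in> G_space N" and H: "H \<in> G_space N"
  shows "bracket_sum N F (G_bracket N G H) k = (\<Sum>(l, a, b)\<in>triples N k. triple_bracket N F G H l a b)"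
proof -
  let ?I = "\<lambda>k. {(l, j). l \<in> {1..N} \<and> j \<in> {1..N} \<and> min (l + j - 1) N = k}"
  have "g_bracket N (eps l N (F l)) (eps m N (G_bracket N G H m)) =
      (\<Sum>(a, b)\<in>?I m. triple_bracket N F G H l a b)" if m: "m \<in> {1..N}" for l m
    unfolding eps_G_bracket[OF G H m] bracket_sum_def triple_bracket_def case_prod_beta
    by (rule g_bracket_sum_right) (auto intro!: g_bracket_smooth eps_G_space_smooth G H)
  then have "bracket_sum N F (G_bracket N G H) k =
      (\<Sum>(l, m)\<in>?I k. \<Sum>(a, b)\<in>?I m. triple_bracket N F G H l a b)"
    unfolding bracket_sum_def[of N F] by (intro sum.cong) auto
  also have "\<dots> = (\<Sum>p\<in>?I k. \<Sum>q\<in>?I (snd p). triple_bracket N F G H (fst p) (fst q) (snd q))"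
    by (simp add: case_prod_beta)
  also have "\<dots> = (\<Sum>(p, q)\<in>(SIGMA p:?I k. ?I (snd p)). triple_bracket N F G H (fst p) (fst q) (snd q))"
    by (rule sum.Sigma) (use finite_index_pairs in \<open>auto simp del: atLeastAtMost_iff\<close>)
  also have "\<dots> = (\<Sum>(l, a, b)\<in>triples N k. triple_bracket N F G H l a b)"
    \<comment> \<open>The intermediate degree is determined by \<open>a\<close> and
      \<open>b\<close>, so dropping it from the index is a bijection.\<close>
    by (rule sum.reindex_bij_witness[of _ "\<lambda>(l, a, b). ((l, min (a + b - 1) N), (a, b))"
          "\<lambda>(p, q). (fst p, fst q, snd q)"])
      (auto simp: triples_def)
  finally show ?thesis .
qed

lemma triple_sum_rotate:
  "(\<Sum>(l, a, b)\<in>triples N k. T l a b) = (\<Sum>(l, a, b)\<in>triples N k. T a b l)"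
  by (rule sum.reindex_bij_witness[of _ "\<lambda>(l, a, b). (a, b, l)" "\<lambda>(a, b, l). (l, a, b)"])
    (auto simp: triples_def add_ac)

lemma G_bracket_jacobi:
  assumes F: "F \<in> G_space N" and G: "G \<in> G_space N" and H: "H \<in> G_space N"
  shows "G_bracket N F (G_bracket N G H) + G_bracket N G (G_bracket N H F)
    + G_bracket N H (G_bracket N F G) = 0" (is "?J = 0")
proof (rule G_space_eqI)
  note closed = G_bracket_closed[OF G H] G_bracket_closed[OF H F] G_bracket_closed[OF F G]
  show "?J \<in> G_space N"
    by (intro subspace_add[OF subspace_G_space] G_bracket_closed F G H)
  show "0 \<in> G_space N" by (rule subspace_0[OF subspace_G_space])
  fix k assume k: "k \<in> {1..N}"
  have "eps k N (?J k) = bracket_sum N F (G_bracket N G H) k + bracket_sum N G (G_bracket N H F) k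
      + bracket_sum N H (G_bracket N F G) k"
    by (simp add: plus_fun_apply eps_add eps_G_bracket[OF F closed(1) k] eps_G_bracket[OF G closed(2) k]
        eps_G_bracket[OF H closed(3) k])
  \<comment> \<open>Rotated so that \<open>l\<close>, \<open>a\<close>, \<open>b\<close> are always
    the degrees taken from \<open>F\<close>, \<open>G\<close>, \<open>H\<close>; the last sum needs
    two rotations.\<close>
  also have "\<dots> = (\<Sum>(l, a, b)\<in>triples N k. triple_bracket N F G H l a b)
      + (\<Sum>(l, a, b)\<in>triples N k. triple_bracket N G H F a b l)
      + (\<Sum>(l, a, b)\<in>triples N k. triple_bracket N H F G b l a)"
    unfolding bracket_sum_G_bracket[OF F G H] bracket_sum_G_bracket[OF G H F] bracket_sum_G_bracket[OF H F G]
    using triple_sum_rotate[of "triple_bracket N G H F" N k]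
      triple_sum_rotate[of "triple_bracket N H F G" N k]
      triple_sum_rotate[of "\<lambda>l a b. triple_bracket N H F G a b l" N k] by simp
  also have "\<dots> = (\<Sum>(l, a, b)\<in>triples N k. triple_bracket N F G H l a b
      + triple_bracket N G H F a b l + triple_bracket N H F G b l a)"
    by (simp add: sum.distrib case_prod_beta)
  also have "\<dots> = 0"
    using g_bracket_jacobi[OF eps_G_space_smooth[OF F] eps_G_space_smooth[OF G] eps_G_space_smooth[OF H]]
    by (intro sum.neutral) (auto simp: triples_def triple_bracket_def)
  also have "0 = eps k N (0 :: 'a observable)" using eps_scale[of k N 0 0] by simp
  finally show "eps k N (?J k) = eps k N (0 k)" by (simp add: zero_fun_apply)
qed

text \<open>The embeddings and the bracket are continuous for the topologies of all smooth
  functions; the symmetric spaces enter by the inclusion at the start and by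
  \<open>continuous_inv_eps\<close> at the end.\<close>

lemma continuous_G_bracket:
  "continuous_map (prod_topology (G_topology N) (G_topology N))
    (G_topology N :: (nat \<Rightarrow> 'd::finite observable) topology) (\<lambda>(F, G). G_bracket N F G)"
    (is "continuous_map ?X _ _")
proof (rule continuous_into_G_topology)
  fix x :: "(nat \<Rightarrow> 'd observable) \<times> (nat \<Rightarrow> 'd observable)"
  assume "x \<in> topspace ?X"
  then show "(case x of (F, G) \<Rightarrow> G_bracket N F G) \<in> G_space N"
    by (auto simp: topspace_G_topology G_bracket_closed)
next
  fix k assume k: "k \<in> {1..N}"
  have comp: "continuous_map ?X (smooth_topology l) (\<lambda>x. fst x l)"
    "continuous_map ?X (smooth_topology l) (\<lambda>x. snd x l)" if l: "l \<in> {1..N}" for l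
  proof -
    have "continuous_map (G_topology N) (smooth_topology l) (\<lambda>F :: nat \<Rightarrow> 'd observable. F l)"
      using continuous_map_compose[OF continuous_G_component[OF l, unfolded g_topology_eq]
          smooth.continuous_inclusion[OF subspace_g_space g_space_smooth]] by (simp add: comp_def)
    then show "continuous_map ?X (smooth_topology l) (\<lambda>x. fst x l)"
      "continuous_map ?X (smooth_topology l) (\<lambda>x. snd x l)"
      using continuous_map_compose[OF continuous_map_fst] continuous_map_compose[OF continuous_map_snd]
      by (fastforce simp: comp_def)+
  qed
  have "continuous_map ?X (smooth_topology N) (\<lambda>x. bracket_sum N (fst x) (snd x) k)"
    unfolding bracket_sum_def case_prod_beta
    by (intro smooth.continuous_sum continuous_g_bracket continuous_eps comp) auto
  then have "continuous_map ?X (g_topology k)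
      (\<lambda>x. inv_into (g_space k) (eps k N) (bracket_sum N (fst x) (snd x) k))"
    using k by (intro continuous_inv_eps) (auto simp: topspace_G_topology intro: bracket_sum_in_image)
  then show "continuous_map ?X (g_topology k) (\<lambda>x. (case x of (F, G) \<Rightarrow> G_bracket N F G) k)"
    by (simp add: case_prod_beta G_bracket_eq[OF k])
qed

theorem theorem2p5:
  fixes N :: nat
  shows "lie_algebra (G_space N :: (nat \<Rightarrow> 'd::finite observable) set) (G_topology N) (G_bracket N)
    \<and> continuous_map
        (prod_topology (G_topology N) (G_topology N))
        (G_topology N :: (nat \<Rightarrow> 'd observable) topology)
        (\<lambda>(F, G). G_bracket N F G)"
proof (rule conjI[OF _ continuous_G_bracket])
  let ?V = "G_space N :: (nat \<Rightarrow> 'd observable) set"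
  have lcs: "locally_convex_space ?V (G_topology N)"
    unfolding G_topology_eq by (rule seminorm_family.locally_convex[OF G_seminorm_family])
  have add_right: "G_bracket N F (G + H) = G_bracket N F G + G_bracket N F H"
    if F: "F \<in> ?V" and G: "G \<in> ?V" and H: "H \<in> ?V" for F G H
    using G_bracket_antisym[OF F subspace_add[OF subspace_G_space G H]]
      G_bracket_antisym[OF F G] G_bracket_antisym[OF F H] G_bracket_add_left[OF G H F] by simp
  have scale_right: "G_bracket N F (c *\<^sub>R G) = c *\<^sub>R G_bracket N F G"
    if F: "F \<in> ?V" and G: "G \<in> ?V" for F G c
    using G_bracket_antisym[OF F subspace_scale[OF subspace_G_space G, of c]]
      G_bracket_antisym[OF F G] G_bracket_scale_left[OF G F, of c] by simp
  show "lie_algebra ?V (G_topology N) (G_bracket N)"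
    by (intro lie_algebra.intro lie_algebra_axioms.intro lcs G_bracket_closed G_bracket_add_left
        G_bracket_scale_left add_right scale_right G_bracket_antisym G_bracket_jacobi)
qed

end
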